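(* Let $q$ be a prime power, let $n \geq 5$ be an integer and let $S \subset \mathbb{F}_q^n$. Let $\tau > 0$ be a real number and $\delta \in (0,1)$ such that $$q \geq 32\max\left(\frac{n(1+\tau)}{(\tau\delta)^2},\, n\right).$$ Suppose $q^r < |S| \leq q^{r+1}$ for some integer $4 \leq r \leq n-1$, and let $t = r-3$. Then at least a $(1-\delta)$-fraction of all surjective linear maps $L : \mathbb{F}_q^n \to \mathbb{F}_q^t$ are such that $L(U_S)$ is $\tau/q^t$-close to the uniform distribution in the $\ell_\infty$ norm, i.e. for every $y \in \mathbb{F}_q^t$, $$\left|\Pr[L(U_S) = y] - q^{-t}\right| \leq \tau q^{-t}.$$
   Context: $U_S$ denotes a random variable distributed uniformly on the finite set $S$. A random variable $X$ on a finite set $Y$ is said to be $\epsilon$-close to uniform in the $\ell_\infty$ norm if $|\Pr[X=y] - 1/|Y|| \leq \epsilon$ for every $y \in Y$. *)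

theory Defs
  imports Complex_Main
begin

definition vecs :: "nat \<Rightarrow> (nat \<Rightarrow> 'a::zero) set" where
  "vecs n = {x. \<forall>j\<ge>n. x j = 0}"

text \<open>Linear maps F_q^n -> F_q^t are represented by their t x n matrices.\<close>
definition mats :: "nat \<Rightarrow> nat \<Rightarrow> (nat \<Rightarrow> nat \<Rightarrow> 'a::zero) set" where
  "mats t n = {M. \<forall>i j. (t \<le> i \<or> n \<le> j) \<longrightarrow> M i j = 0}"

definition apply_mat :: "nat \<Rightarrow> nat \<Rightarrow> (nat \<Rightarrow> nat \<Rightarrow> 'a::comm_semiring_0) \<Rightarrow> (nat \<Rightarrow> 'a) \<Rightarrow> (nat \<Rightarrow> 'a)" where
  "apply_mat t n M x = (\<lambda>i. if i < t then (\<Sum>j<n. M i j * x j) else 0)"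

definition surj_lin_maps :: "nat \<Rightarrow> nat \<Rightarrow> (nat \<Rightarrow> nat \<Rightarrow> 'a::comm_semiring_0) set" where
  "surj_lin_maps t n = {M \<in> mats t n. apply_mat t n M ` vecs n = vecs t}"

definition prob_image :: "(nat \<Rightarrow> 'a) set \<Rightarrow> ((nat \<Rightarrow> 'a) \<Rightarrow> (nat \<Rightarrow> 'b)) \<Rightarrow> (nat \<Rightarrow> 'b) \<Rightarrow> real" where
  "prob_image S L y = real (card {x \<in> S. L x = y}) / real (card S)"

definition close_to_uniform :: "nat \<Rightarrow> real \<Rightarrow> (nat \<Rightarrow> 'a::{finite,zero}) set \<Rightarrow> ((nat \<Rightarrow> 'a) \<Rightarrow> (nat \<Rightarrow> 'a)) \<Rightarrow> bool" where
  "close_to_uniform t eps S L =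
     (\<forall>y \<in> vecs t. \<bar>prob_image S L y - 1 / real (card (UNIV :: 'a set)) ^ t\<bar> \<le> eps)"

end

theory Submission
  imports Defs "HOL-Computational_Algebra.Polynomial" "HOL-Library.FuncSet"
begin

text \<open>
  Put \<open>t = r - 3\<close>, \<open>m = t + 2\<close> and \<open>\<mu> = |S| / q ^ m > q\<close>. Extend a bad map \<open>L\<close> by two random rows to
  \<open>G : F ^ n \<rightarrow> F ^ m\<close>. By pairwise independence the points of \<open>S\<close> in an unbalanced fibre of \<open>L\<close> spread
  evenly over the \<open>q\<^sup>2\<close> fibres of \<open>G\<close> inside it, so almost all points of the plane \<open>{y} \<times> F\<^sup>2\<close> lie in the
  set of \<open>u\<close> whose \<open>G\<close>-fibre deviates from \<open>\<mu>\<close> by \<open>\<tau>\<mu>/2\<close>. The same second moment, taken over all of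
  \<open>S\<close>, shows that this deviant set has average density at most \<open>\<delta>\<^sup>2 / 8n\<close>. If a \<open>\<delta>\<close>-fraction of the maps
  were bad, then by symmetry every plane direction would be covered by a \<open>\<delta>/4\<close>-fraction of the \<open>G\<close>, and
  a greedily chosen union of deviant sets would have density at most 1/2 although it almost contains a
  plane in at least half of all directions \<open>(b1, b2)\<close>.

  The method of multiplicities excludes this. A nonzero polynomial vanishing to high order on the union
  vanishes on these planes, so its top form vanishes to high order at the points \<open>b1 + z b2\<close> of
  \<open>F[z] ^ m\<close>. These lie in a grid of side \<open>q\<^sup>2\<close>, not \<open>q\<close>; the gain in the Schwartz-Zippel bound forces
  the union to have density at least \<open>(1 - O(1/n)) ^ m\<close>, a constant because \<open>q \<ge> 32 n\<close>. Working over
  \<open>F[z]\<close> replaces the passage to the quadratic extension of \<open>F\<close>.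
\<close>

section \<open>Exponents and Taylor coefficients\<close>

text \<open>Boxes in \<open>m\<close> coordinates, padded by zero so that a point is determined by
  its first \<open>m\<close> values and finite boxes can be counted.\<close>

definition grid :: "nat \<Rightarrow> (nat \<Rightarrow> 'b set) \<Rightarrow> (nat \<Rightarrow> 'b::zero) set" where
  "grid m A = {x. (\<forall>i<m. x i \<in> A i) \<and> (\<forall>i\<ge>m. x i = 0)}"

lemma grid_0 [simp]: "grid 0 A = {\<lambda>_. 0}"
  by (auto simp: grid_def)

lemma grid_Suc: "grid (Suc m) A = (\<lambda>(x, a). x(m := a)) ` (grid m A \<times> A m)"
proof (intro equalityI subsetI)
  fix x assume "x \<in> grid (Suc m) A"
  then have "x = (\<lambda>(x, a). x(m := a)) (x(m := 0), x m)" "(x(m := 0), x m) \<in> grid m A \<times> A m"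
    by (auto simp: grid_def)
  then show "x \<in> (\<lambda>(x, a). x(m := a)) ` (grid m A \<times> A m)" by blast
qed (auto simp: grid_def less_Suc_eq)

lemma inj_on_grid_upd: "inj_on (\<lambda>(x, a). x(m := a)) (grid m A \<times> B)"
proof (rule inj_onI, clarify)
  fix x a y b assume x: "x \<in> grid m A" and y: "y \<in> grid m A" and eq: "x(m := a) = y(m := b)"
  have "x i = y i" for i
    using fun_cong[OF eq, of i] x y by (cases "i = m") (auto simp: grid_def)
  moreover have "a = b" using fun_cong[OF eq, of m] by simp
  ultimately show "x = y \<and> a = b" by auto
qed

lemma sum_grid_Suc:
  "sum f (grid (Suc m) A) = (\<Sum>x\<in>grid m A. \<Sum>a\<in>A m. f (x(m := a)))"
  unfolding grid_Suc sum.reindex[OF inj_on_grid_upd] sum.cartesian_product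
  by (simp add: case_prod_unfold o_def)

lemma finite_grid: "(\<And>i. i < m \<Longrightarrow> finite (A i)) \<Longrightarrow> finite (grid m A)"
  by (induction m) (auto simp: grid_Suc)

lemma card_grid: "card (grid m A) = (\<Prod>i<m. card (A i))"
proof (induction m)
  case (Suc m)
  then show ?case
    by (simp add: grid_Suc card_image[OF inj_on_grid_upd] card_cartesian_product)
qed simp

lemma prod_sum_grid:
  fixes f :: "nat \<Rightarrow> 'b::zero \<Rightarrow> 'r::comm_semiring_1"
  shows "(\<Prod>i<m. \<Sum>a\<in>A i. f i a) = (\<Sum>x\<in>grid m A. \<Prod>i<m. f i (x i))"
proof (induction m)
  case (Suc m)
  have "(\<Sum>x\<in>grid (Suc m) A. \<Prod>i<Suc m. f i (x i))
      = (\<Sum>x\<in>grid m A. \<Sum>a\<in>A m. (\<Prod>i<m. f i (x i)) * f m a)"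
    unfolding sum_grid_Suc by (intro sum.cong refl) (auto intro!: prod.cong arg_cong2[of _ _ _ _ times])
  also have "\<dots> = (\<Sum>x\<in>grid m A. \<Prod>i<m. f i (x i)) * (\<Sum>a\<in>A m. f m a)"
    by (simp add: sum_product)
  finally show ?case using Suc by simp
qed simp

definition expos :: "nat \<Rightarrow> nat \<Rightarrow> (nat \<Rightarrow> nat) set" where
  "expos m d = {\<alpha>. (\<forall>i\<ge>m. \<alpha> i = 0) \<and> sum \<alpha> {..<m} \<le> d}"

lemma expos_0 [simp]: "expos 0 d = {\<lambda>_. 0}"
  by (auto simp: expos_def)

lemma expos_le: "\<alpha> \<in> expos m d \<Longrightarrow> \<alpha> i \<le> d"
proof -
  assume a: "\<alpha> \<in> expos m d"
  show ?thesis
  proof (cases "i < m")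
    case True
    then have "\<alpha> i \<le> sum \<alpha> {..<m}" by (intro member_le_sum) auto
    with a show ?thesis by (auto simp: expos_def)
  qed (use a in \<open>auto simp: expos_def\<close>)
qed

lemma finite_expos [simp]: "finite (expos m d)"
proof (rule finite_subset)
  show "expos m d \<subseteq> grid m (\<lambda>_. {..d})"
    using expos_le by (auto simp: grid_def) (auto simp: expos_def)
qed (auto intro!: finite_grid)

lemma expos_Suc: "expos (Suc m) d = (\<lambda>(j, \<alpha>). \<alpha>(m := j)) ` (SIGMA j:{..d}. expos m (d - j))"
proof (intro equalityI subsetI)
  fix \<alpha> assume a: "\<alpha> \<in> expos (Suc m) d"
  have "sum (\<alpha>(m := 0)) {..<m} = sum \<alpha> {..<m}" by (intro sum.cong) auto
  then have "\<alpha>(m := 0) \<in> expos m (d - \<alpha> m)" "\<alpha> m \<le> d"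
    using a by (auto simp: expos_def)
  then show "\<alpha> \<in> (\<lambda>(j, \<alpha>). \<alpha>(m := j)) ` (SIGMA j:{..d}. expos m (d - j))"
    by (intro image_eqI[of _ _ "(\<alpha> m, \<alpha>(m := 0))"]) auto
next
  fix \<alpha> assume "\<alpha> \<in> (\<lambda>(j, \<alpha>). \<alpha>(m := j)) ` (SIGMA j:{..d}. expos m (d - j))"
  then obtain j \<beta> where b: "j \<le> d" "\<beta> \<in> expos m (d - j)" and a: "\<alpha> = \<beta>(m := j)" by auto
  have "sum (\<beta>(m := j)) {..<m} = sum \<beta> {..<m}" by (intro sum.cong) auto
  then show "\<alpha> \<in> expos (Suc m) d" using b unfolding a by (auto simp: expos_def)
qed

lemma inj_on_expos_upd: "inj_on (\<lambda>(j, \<alpha>). \<alpha>(m := j)) (SIGMA j:{..d}. expos m (d - j))"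
proof (rule inj_onI, clarify)
  fix j k \<alpha> \<beta> assume x: "\<alpha> \<in> expos m (d - j)" "\<beta> \<in> expos m (d - k)" and eq: "\<alpha>(m := j) = \<beta>(m := k)"
  have "\<alpha> i = \<beta> i" for i
    using fun_cong[OF eq, of i] x by (cases "i = m") (auto simp: expos_def)
  moreover have "j = k" using fun_cong[OF eq, of m] by simp
  ultimately show "j = k \<and> \<alpha> = \<beta>" by auto
qed

lemma sum_expos_Suc:
  "sum f (expos (Suc m) d) = (\<Sum>j\<le>d. \<Sum>\<alpha>\<in>expos m (d - j). f (\<alpha>(m := j)))"
  unfolding expos_Suc sum.reindex[OF inj_on_expos_upd]
  by (subst sum.Sigma) (auto simp: case_prod_unfold o_def)

text \<open>Sorting by the last exponent \<open>j\<close> leaves degree \<open>d - j\<close> for the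
  others; the hockey-stick identity adds up the binomials.\<close>

lemma card_expos: "card (expos m d) = (d + m) choose m"
proof (induction m arbitrary: d)
  case (Suc m)
  have "card (expos (Suc m) d) = (\<Sum>j\<le>d. card (expos m (d - j)))"
    using sum_expos_Suc[of "\<lambda>_. 1::nat" m d] by simp
  also have "\<dots> = (\<Sum>j\<le>d. (d - j + m) choose m)" using Suc by simp
  also have "\<dots> = (\<Sum>j\<le>d. (m + j) choose m)"
    by (rule sum.reindex_bij_witness[of _ "\<lambda>j. d - j" "\<lambda>j. d - j"]) (auto simp: add.commute)
  also have "\<dots> = (d + Suc m) choose (Suc m)"
    by (subst choose_rising_sum) (simp add: add.commute)
  finally show ?case .
qed simp

text \<open>
  \<open>taylor m d P a \<beta>\<close> is the coefficient of \<open>x\<^sup>\<beta>\<close> in \<open>P (a + x)\<close>, a Hasse derivative, where the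
  coefficient family \<open>P\<close> of a polynomial in \<open>m\<close> variables is only read on exponents of degree at most \<open>d\<close>.
\<close>

definition taylor ::
    "nat \<Rightarrow> nat \<Rightarrow> ((nat \<Rightarrow> nat) \<Rightarrow> 'r::comm_ring_1) \<Rightarrow> (nat \<Rightarrow> 'r) \<Rightarrow> (nat \<Rightarrow> nat) \<Rightarrow> 'r" where
  "taylor m d P a \<beta> =
     (\<Sum>\<alpha>\<in>expos m d. P \<alpha> * (\<Prod>i<m. of_nat (\<alpha> i choose \<beta> i) * a i ^ (\<alpha> i - \<beta> i)))"

lemma taylor_cong:
  assumes "\<And>\<alpha>. \<alpha> \<in> expos m d \<Longrightarrow> P \<alpha> = Q \<alpha>" "\<And>i. i < m \<Longrightarrow> a i = b i" "\<And>i. i < m \<Longrightarrow> \<beta> i = \<gamma> i"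
  shows "taylor m d P a \<beta> = taylor m d Q b \<gamma>"
  unfolding taylor_def using assms by (intro sum.cong prod.cong arg_cong2[of _ _ _ _ times]) auto

text \<open>Reads a polynomial as a univariate one in the last variable with coefficients in the
  first \<open>m\<close>; the Schwartz-Zippel induction runs on this form.\<close>

lemma taylor_Suc:
  "taylor (Suc m) d P a \<beta> =
     (\<Sum>j\<le>d. taylor m (d - j) (\<lambda>\<alpha>. P (\<alpha>(m := j))) a \<beta> * (of_nat (j choose \<beta> m) * a m ^ (j - \<beta> m)))"
  unfolding taylor_def sum_expos_Suc sum_distrib_right
  by (intro sum.cong refl) (auto simp: mult.assoc intro!: prod.cong arg_cong2[of _ _ _ _ times])

text \<open>Both sides are the coefficient of \<open>x ^ g\<close> in
  \<open>(e + v + x) ^ n\<close>; the right side expands in powers of \<open>v + x\<close> first.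
  For \<open>g > n\<close> both vanish.\<close>

lemma binomial_shift:
  fixes e v :: "'r::comm_ring_1"
  shows "of_nat (n choose g) * (e + v) ^ (n - g) =
    (\<Sum>b\<le>n. (of_nat (b choose g) * v ^ (b - g)) * (of_nat (n choose b) * e ^ (n - b)))"
proof (cases "g \<le> n")
  case True
  have "of_nat (n choose g) * (e + v) ^ (n - g) =
    (\<Sum>k\<le>n - g. of_nat (n choose g) * (of_nat ((n - g) choose k) * v ^ k * e ^ (n - g - k)))"
    by (subst add.commute, subst binomial_ring) (simp add: sum_distrib_left)
  also have "\<dots> = (\<Sum>b\<in>{g..n}. (of_nat (b choose g) * v ^ (b - g)) * (of_nat (n choose b) * e ^ (n - b)))"
  proof (rule sum.reindex_bij_witness[of _ "\<lambda>b. b - g" "\<lambda>k. g + k"])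
    fix k assume k: "k \<in> {..n - g}"
    have "(n choose (g + k)) * ((g + k) choose g) = (n choose g) * ((n - g) choose k)"
      using choose_mult[of g "g + k" n] k True by simp
    then have "of_nat (n choose (g + k)) * of_nat ((g + k) choose g)
        = (of_nat (n choose g) * of_nat ((n - g) choose k) :: 'r)"
      by (metis of_nat_mult)
    then show "of_nat (g + k choose g) * v ^ (g + k - g) * (of_nat (n choose (g + k)) * e ^ (n - (g + k)))
      = of_nat (n choose g) * (of_nat ((n - g) choose k) * v ^ k * e ^ (n - g - k))"
      by (simp add: mult_ac) (metis mult.assoc)
  qed (use True in auto)
  also have "\<dots> = (\<Sum>b\<le>n. (of_nat (b choose g) * v ^ (b - g)) * (of_nat (n choose b) * e ^ (n - b)))"
    by (intro sum.mono_neutral_left) (auto simp: binomial_eq_0)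
  finally show ?thesis .
next
  case False
  then show ?thesis by (auto simp: binomial_eq_0 intro!: sum.neutral[symmetric])
qed

text \<open>Recentring from \<open>e\<close> to \<open>e + v\<close>: the one-variable identity is
  multiplied out over the box of all \<open>\<beta>\<close> below \<open>\<alpha>\<close>.\<close>

lemma taylor_add:
  "taylor m d P (\<lambda>i. e i + v i) \<gamma> =
    (\<Sum>\<beta>\<in>expos m d. (\<Prod>i<m. of_nat (\<beta> i choose \<gamma> i) * v i ^ (\<beta> i - \<gamma> i)) * taylor m d P e \<beta>)"
proof -
  let ?v = "\<lambda>\<beta>. \<Prod>i<m. of_nat (\<beta> i choose \<gamma> i) * v i ^ (\<beta> i - \<gamma> i)"
  let ?e = "\<lambda>\<alpha> \<beta>. \<Prod>i<m. of_nat (\<alpha> i choose \<beta> i) * e i ^ (\<alpha> i - \<beta> i)"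
  have "(\<Prod>i<m. of_nat (\<alpha> i choose \<gamma> i) * (e i + v i) ^ (\<alpha> i - \<gamma> i)) = (\<Sum>\<beta>\<in>expos m d. ?v \<beta> * ?e \<alpha> \<beta>)"
    if \<alpha>: "\<alpha> \<in> expos m d" for \<alpha>
  proof -
    have "(\<Prod>i<m. of_nat (\<alpha> i choose \<gamma> i) * (e i + v i) ^ (\<alpha> i - \<gamma> i))
        = (\<Sum>\<beta>\<in>grid m (\<lambda>i. {..\<alpha> i}). ?v \<beta> * ?e \<alpha> \<beta>)"
      by (simp add: binomial_shift prod_sum_grid prod.distrib)
    \<comment> \<open>Enlarging the box makes the index set independent of \<open>\<alpha>\<close>,
      so that the sums can be swapped; each new term contains a vanishing binomial.\<close>
    also have "\<dots> = (\<Sum>\<beta>\<in>expos m d. ?v \<beta> * ?e \<alpha> \<beta>)"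
    proof (intro sum.mono_neutral_left ballI)
      show "grid m (\<lambda>i. {..\<alpha> i}) \<subseteq> expos m d"
      proof
        fix \<beta> assume b: "\<beta> \<in> grid m (\<lambda>i. {..\<alpha> i})"
        then have "sum \<beta> {..<m} \<le> sum \<alpha> {..<m}" by (intro sum_mono) (auto simp: grid_def)
        with b \<alpha> show "\<beta> \<in> expos m d" by (auto simp: expos_def grid_def)
      qed
      fix \<beta> assume "\<beta> \<in> expos m d - grid m (\<lambda>i. {..\<alpha> i})"
      then obtain i where "i < m" "\<alpha> i < \<beta> i" by (auto simp: expos_def grid_def not_le)
      then have "?e \<alpha> \<beta> = 0" by (intro prod_zero bexI[of _ i]) (auto simp: binomial_eq_0)
      then show "?v \<beta> * ?e \<alpha> \<beta> = 0" by simp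
    qed simp
    finally show ?thesis .
  qed
  then have "taylor m d P (\<lambda>i. e i + v i) \<gamma> = (\<Sum>\<alpha>\<in>expos m d. \<Sum>\<beta>\<in>expos m d. P \<alpha> * (?v \<beta> * ?e \<alpha> \<beta>))"
    unfolding taylor_def by (intro sum.cong refl) (simp add: sum_distrib_left)
  also have "\<dots> = (\<Sum>\<beta>\<in>expos m d. \<Sum>\<alpha>\<in>expos m d. P \<alpha> * (?v \<beta> * ?e \<alpha> \<beta>))" by (rule sum.swap)
  finally show ?thesis
    unfolding taylor_def by (simp add: sum_distrib_left mult_ac)
qed

section \<open>The Schwartz-Zippel bound with multiplicities\<close>

lemma pcompose_monom: "pcompose (monom c n) p = smult c (p ^ n)"
  for c :: "'r::comm_semiring_1"
  by (induction n) (simp_all add: monom_0 monom_Suc pcompose_pCons)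

lemma coeff_pcompose_shift:
  fixes c :: "nat \<Rightarrow> 'r::comm_ring_1"
  shows "coeff (pcompose (\<Sum>j\<le>d. monom (c j) j) [:s, 1:]) k = (\<Sum>j\<le>d. c j * (of_nat (j choose k) * s ^ (j - k)))"
proof -
  have "coeff (pcompose (monom (c j) j) [:s, 1:]) k = c j * (of_nat (j choose k) * s ^ (j - k))" for j
  proof (cases "k \<le> j")
    case False
    then have "degree ([:s, 1:] ^ j) < k" by (simp add: degree_linear_power)
    with False show ?thesis by (simp add: pcompose_monom coeff_eq_0 binomial_eq_0)
  qed (simp add: pcompose_monom coeff_linear_poly_power)
  then show ?thesis by (simp add: pcompose_sum coeff_sum)
qed

text \<open>The orders of the roots add up to at most the degree. The allowance \<open>\<nu>\<close>
  stands for derivatives already spent in other variables: \<open>Q\<close> vanishes at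
  \<open>s\<close> only to order \<open>\<mu> s - \<nu>\<close>.\<close>

lemma sum_multiplicity_le:
  fixes Q :: "'r::idom poly"
  assumes "Q \<noteq> 0" "degree Q \<le> t" "finite S"
    and van: "\<And>s k. s \<in> S \<Longrightarrow> \<nu> + k < \<mu> s \<Longrightarrow> coeff (pcompose Q [:s, 1:]) k = 0"
  shows "sum \<mu> S \<le> card S * \<nu> + t"
proof -
  have le: "\<mu> s \<le> \<nu> + order s Q" if s: "s \<in> S" for s
  proof (cases "\<nu> < \<mu> s")
    case True
    define k where "k = \<mu> s - \<nu>"
    have "monom 1 k dvd pcompose Q [:s, 1:]"
      using van[OF s] True by (auto simp: monom_1_dvd_iff' k_def)
    then obtain R where R: "pcompose Q [:s, 1:] = monom 1 k * R" by (auto simp: dvd_def)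
    have "Q = pcompose (pcompose Q [:s, 1:]) [:-s, 1:]"
      by (simp add: pcompose_assoc[symmetric] pcompose_pCons)
    also have "\<dots> = [:-s, 1:] ^ k * pcompose R [:-s, 1:]"
      by (simp add: R pcompose_mult pcompose_monom)
    finally have "[:-s, 1:] ^ k dvd Q" by (metis dvd_triv_left)
    then show ?thesis using \<open>Q \<noteq> 0\<close> order_divides[of s k Q] by (simp add: k_def)
  qed simp
  have "sum \<mu> S \<le> (\<Sum>s\<in>S. \<nu> + order s Q)" using le by (rule sum_mono)
  also have "\<dots> = card S * \<nu> + (\<Sum>s\<in>S. order s Q)" by (simp add: sum.distrib)
  also have "(\<Sum>s\<in>S. order s Q) = (\<Sum>s\<in>{s\<in>S. poly Q s = 0}. order s Q)"
    using assms(3) by (intro sum.mono_neutral_right) (auto simp: order_0I)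
  also have "\<dots> \<le> (\<Sum>s | poly Q s = 0. order s Q)"
    using poly_roots_finite[OF \<open>Q \<noteq> 0\<close>] by (intro sum_mono2) auto
  also have "\<dots> \<le> t" using sum_order_le_degree[OF \<open>Q \<noteq> 0\<close>] assms(2) by simp
  finally show ?thesis by simp
qed

text \<open>Induction on the number of variables. If \<open>t\<close> is the degree in the last
  variable, the leading slice has degree at most \<open>d - t\<close> and vanishes at
  \<open>a\<close> to an exact order \<open>\<nu> a\<close>. Some derivative of that order leaves a
  nonzero univariate polynomial of degree \<open>t\<close> on the line over \<open>a\<close>, which
  therefore carries multiplicity at most \<open>card S * \<nu> a + t\<close>. The induction
  hypothesis bounds the sum of \<open>\<nu>\<close>.\<close>

theorem schwartz_zippel_multiplicity:
  fixes P :: "(nat \<Rightarrow> nat) \<Rightarrow> 'r::idom"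
  assumes "finite S" "S \<noteq> {}" "\<alpha> \<in> expos m d" "P \<alpha> \<noteq> 0"
    and "\<And>a \<beta>. a \<in> grid m (\<lambda>_. S) \<Longrightarrow> sum \<beta> {..<m} < \<mu> a \<Longrightarrow> taylor m d P a \<beta> = 0"
  shows "card S * sum \<mu> (grid m (\<lambda>_. S)) \<le> d * card S ^ m"
  using assms(3-5)
proof (induction m arbitrary: d P \<mu> \<alpha>)
  case 0
  have "\<mu> (\<lambda>_. 0) = 0"
  proof (rule ccontr)
    assume "\<mu> (\<lambda>_. 0) \<noteq> 0"
    then have "taylor 0 d P (\<lambda>_. 0) (\<lambda>_. 0) = 0" using 0(3)[of "\<lambda>_. 0" "\<lambda>_. 0"] by simp
    with 0(1,2) show False by (simp add: taylor_def)
  qed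
  then show ?case by simp
next
  case (Suc m)
  let ?q = "card S" and ?G = "grid m (\<lambda>_. S)"
  define slice where "slice j = (\<lambda>\<alpha>. P (\<alpha>(m := j)))" for j :: nat
  define J where "J = {j. j \<le> d \<and> (\<exists>\<alpha>\<in>expos m (d - j). slice j \<alpha> \<noteq> 0)}"
  have "finite J" by (rule finite_subset[of _ "{..d}"]) (auto simp: J_def)
  moreover have "J \<noteq> {}"
    using Suc.prems(1,2) by (auto simp: expos_Suc J_def slice_def)
  define t where "t = Max J"
  ultimately have tJ: "t \<in> J" and tmax: "\<And>j. j \<in> J \<Longrightarrow> j \<le> t"
    using \<open>J \<noteq> {}\<close> by (auto simp: t_def)
  then have td: "t \<le> d" by (simp add: J_def)
  obtain \<gamma> where \<gamma>: "\<gamma> \<in> expos m (d - t)" "slice t \<gamma> \<noteq> 0" using tJ by (auto simp: J_def)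
  let ?T = "\<lambda>j. taylor m (d - j) (slice j)"
  have T0: "?T j a \<beta> = 0" if "j \<le> d" "t < j" for j a \<beta>
    unfolding taylor_def
    using tmax[of j] that by (intro sum.neutral) (auto simp: J_def)
  have ex: "\<exists>\<beta>. ?T t a \<beta> \<noteq> 0" if a: "a \<in> ?G" for a
  proof (rule ccontr)
    assume *: "\<nexists>\<beta>. ?T t a \<beta> \<noteq> 0"
    \<comment> \<open>If every Taylor coefficient at \<open>a\<close> vanished, any multiplicity
      could be claimed there; this \<open>N\<close> exceeds what the induction hypothesis allows for
      the whole box.\<close>
    define N where "N = (d - t) * ?q ^ m + 1"
    have "?q * (\<Sum>x\<in>?G. if x = a then N else 0) \<le> (d - t) * ?q ^ m"
      using * by (intro Suc.IH[of \<gamma> _ "slice t", OF \<gamma>]) (auto split: if_splits)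
    moreover have "(\<Sum>x\<in>?G. if x = a then N else 0) = N"
      using a assms(1) finite_grid[of m "\<lambda>_. S"] by simp
    moreover have "?q \<ge> 1" using assms(1,2) by (simp add: Suc_leI card_gt_0_iff)
    ultimately show False unfolding N_def
      by (metis One_nat_def Suc_eq_plus1 Suc_n_not_le_n le_trans mult_le_mono1 nat_mult_1)
  qed
  define w where "w a = (\<lambda>n. \<exists>\<beta>. ?T t a \<beta> \<noteq> 0 \<and> sum \<beta> {..<m} = n)" for a
  define \<nu> where "\<nu> a = (LEAST n. w a n)" for a
  have w\<nu>: "w a (\<nu> a)" if "a \<in> ?G" for a
    unfolding \<nu>_def using ex[OF that] by (auto simp: w_def intro: LeastI)
  have IH: "?q * sum \<nu> ?G \<le> (d - t) * ?q ^ m"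
    using not_less_Least by (intro Suc.IH[of \<gamma> _ "slice t", OF \<gamma>]) (auto simp: \<nu>_def w_def)
  have fiber: "(\<Sum>s\<in>S. \<mu> (a(m := s))) \<le> ?q * \<nu> a + t" if a: "a \<in> ?G" for a
  proof -
    obtain \<beta> where \<beta>: "?T t a \<beta> \<noteq> 0" "sum \<beta> {..<m} = \<nu> a" using w\<nu>[OF a] by (auto simp: w_def)
    \<comment> \<open>Its coefficient of degree \<open>t\<close> is nonzero by the choice of
      \<open>\<beta>\<close>, and the higher ones vanish by \<open>T0\<close>.\<close>
    define Q where "Q = (\<Sum>j\<le>d. monom (?T j a \<beta>) j)"
    have cQ: "coeff Q j = (if j \<le> d then ?T j a \<beta> else 0)" for j
      by (simp add: Q_def coeff_sum coeff_monom)
    show ?thesis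
    proof (rule sum_multiplicity_le)
      show "Q \<noteq> 0" using cQ[of t] \<beta>(1) td by (metis coeff_0)
      show "degree Q \<le> t" using T0 by (intro degree_le) (auto simp: cQ)
      fix s k assume s: "s \<in> S" and k: "\<nu> a + k < \<mu> (a(m := s))"
      have "taylor (Suc m) d P (a(m := s)) (\<beta>(m := k)) = 0"
      proof (rule Suc.prems(3))
        show "a(m := s) \<in> grid (Suc m) (\<lambda>_. S)"
          using a s by (auto simp: grid_def less_Suc_eq)
        have "sum (\<beta>(m := k)) {..<m} = sum \<beta> {..<m}" by (intro sum.cong) auto
        then show "sum (\<beta>(m := k)) {..<Suc m} < \<mu> (a(m := s))" using \<beta>(2) k by simp
      qed
      moreover have "taylor m (d - j) (slice j) (a(m := s)) (\<beta>(m := k)) = ?T j a \<beta>" for j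
        by (rule taylor_cong) auto
      ultimately show "coeff (pcompose Q [:s, 1:]) k = 0"
        by (simp add: Q_def coeff_pcompose_shift taylor_Suc slice_def)
    qed (rule assms(1))
  qed
  have "sum \<mu> (grid (Suc m) (\<lambda>_. S)) \<le> (\<Sum>a\<in>?G. ?q * \<nu> a + t)"
    unfolding sum_grid_Suc by (rule sum_mono[OF fiber])
  also have "\<dots> = ?q * sum \<nu> ?G + t * ?q ^ m"
    by (simp add: sum.distrib sum_distrib_left card_grid mult.commute)
  also have "\<dots> \<le> (d - t) * ?q ^ m + t * ?q ^ m" using IH by simp
  also have "\<dots> = d * ?q ^ m" using td by (simp add: distrib_right[symmetric])
  finally show ?case by simp
qed

section \<open>Ring homomorphisms and their action on Taylor coefficients\<close>

definition hom :: "('r::comm_ring_1 \<Rightarrow> 's::comm_ring_1) \<Rightarrow> bool" where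
  "hom \<phi> \<longleftrightarrow> \<phi> 1 = 1 \<and> (\<forall>x y. \<phi> (x + y) = \<phi> x + \<phi> y) \<and> (\<forall>x y. \<phi> (x * y) = \<phi> x * \<phi> y)"

lemma hom_1: "hom \<phi> \<Longrightarrow> \<phi> 1 = 1" and hom_add: "hom \<phi> \<Longrightarrow> \<phi> (x + y) = \<phi> x + \<phi> y"
  and hom_mult: "hom \<phi> \<Longrightarrow> \<phi> (x * y) = \<phi> x * \<phi> y"
  by (simp_all add: hom_def)

lemma hom_0: "hom \<phi> \<Longrightarrow> \<phi> 0 = 0"
  using hom_add[of \<phi> 0 0] by simp

lemma hom_sum: "hom \<phi> \<Longrightarrow> \<phi> (sum f A) = (\<Sum>x\<in>A. \<phi> (f x))"
  by (induction A rule: infinite_finite_induct) (auto simp: hom_0 hom_add)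

lemma hom_prod: "hom \<phi> \<Longrightarrow> \<phi> (prod f A) = (\<Prod>x\<in>A. \<phi> (f x))"
  by (induction A rule: infinite_finite_induct) (auto simp: hom_1 hom_mult)

lemma hom_power: "hom \<phi> \<Longrightarrow> \<phi> (x ^ n) = \<phi> x ^ n"
  by (induction n) (auto simp: hom_1 hom_mult)

lemma hom_of_nat: "hom \<phi> \<Longrightarrow> \<phi> (of_nat n) = of_nat n"
  by (induction n) (auto simp: hom_0 hom_1 hom_add)

lemma hom_comp: "hom \<phi> \<Longrightarrow> hom \<psi> \<Longrightarrow> hom (\<lambda>x. \<psi> (\<phi> x))"
  by (simp add: hom_def)

lemma hom_const: "hom (\<lambda>c. [:c:])"
  by (simp add: hom_def one_pCons)

lemma hom_pcompose: "hom (\<lambda>p. pcompose p q)"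
  by (simp add: hom_def pcompose_1 pcompose_add pcompose_mult)

lemma hom_poly: "hom (\<lambda>p. poly p x)"
  by (simp add: hom_def)

lemma hom_map_poly: "hom \<phi> \<Longrightarrow> hom (map_poly \<phi>)"
  unfolding hom_def[of "map_poly \<phi>"]
  by (auto intro!: poly_eqI simp: coeff_map_poly hom_0 hom_1 hom_add hom_mult hom_sum coeff_mult)

text \<open>A Taylor coefficient is an integer polynomial in the coefficients and the base point.
  Translations and substitutions in a plane are homomorphisms, so they can be carried out on these
  data.\<close>

lemma hom_taylor: "hom \<phi> \<Longrightarrow> \<phi> (taylor m d P a \<beta>) = taylor m d (\<lambda>\<alpha>. \<phi> (P \<alpha>)) (\<lambda>i. \<phi> (a i)) \<beta>"
  by (simp add: taylor_def hom_sum hom_mult hom_prod hom_power hom_of_nat)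

text \<open>Elements of \<^typ>\<open>'r poly poly\<close> are polynomials in an inner variable \<open>X\<close> and an outer variable \<open>Y\<close>.\<close>

definition low :: "nat \<Rightarrow> 'r::comm_ring_1 poly poly \<Rightarrow> bool" where
  "low n F \<longleftrightarrow> (\<forall>k l. k + l < n \<longrightarrow> coeff (coeff F k) l = 0)"

definition up :: "nat \<Rightarrow> 'r::comm_ring_1 poly poly \<Rightarrow> bool" where
  "up n F \<longleftrightarrow> (\<forall>k l. n < k + l \<longrightarrow> coeff (coeff F k) l = 0)"

lemma coeff_coeff_mult:
  "coeff (coeff (F * G) k) l =
    (\<Sum>i\<le>k. \<Sum>j\<le>l. coeff (coeff F i) j * coeff (coeff G (k - i)) (l - j))"
  by (simp add: coeff_mult coeff_sum)

text \<open>\<open>low n\<close> is vanishing to order \<open>n\<close> at the origin,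
  \<open>up n\<close> is total degree at most \<open>n\<close>. Both add up under products, because
  in every relevant product of coefficients one factor is forced to vanish.\<close>

lemma low_mult: assumes "low a F" "low b G" shows "low (a + b) (F * G)"
  unfolding low_def coeff_coeff_mult
proof (intro allI impI sum.neutral ballI)
  fix k l i j assume *: "k + l < a + b" "i \<in> {..k}" "j \<in> {..l}"
  then consider "i + j < a" | "(k - i) + (l - j) < b" by fastforce
  then show "coeff (coeff F i) j * coeff (coeff G (k - i)) (l - j) = 0"
    by cases (use assms in \<open>auto simp: low_def\<close>)
qed

lemma up_mult: assumes "up a F" "up b G" shows "up (a + b) (F * G)"
  unfolding up_def coeff_coeff_mult
proof (intro allI impI sum.neutral ballI)
  fix k l i j assume *: "a + b < k + l" "i \<in> {..k}" "j \<in> {..l}"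
  then consider "a < i + j" | "b < (k - i) + (l - j)" by fastforce
  then show "coeff (coeff F i) j * coeff (coeff G (k - i)) (l - j) = 0"
    by cases (use assms in \<open>auto simp: up_def\<close>)
qed

lemma low_0: "low 0 F"
  by (simp add: low_def)

lemma low_mono: "low a F \<Longrightarrow> b \<le> a \<Longrightarrow> low b F"
  by (auto simp: low_def)

lemma up_mono: "up a F \<Longrightarrow> a \<le> b \<Longrightarrow> up b F"
  by (auto simp: up_def)

lemma low_sum: "(\<And>x. x \<in> A \<Longrightarrow> low n (f x)) \<Longrightarrow> low n (sum f A)"
  by (auto simp: low_def coeff_sum intro!: sum.neutral)

lemma up_sum: "(\<And>x. x \<in> A \<Longrightarrow> up n (f x)) \<Longrightarrow> up n (sum f A)"
  by (auto simp: up_def coeff_sum intro!: sum.neutral)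

lemma up_const: "up 0 [:[:c:]:]"
  by (auto simp: up_def coeff_pCons split: nat.splits)

lemma up_of_nat: "up 0 (of_nat n)"
  by (simp add: of_nat_poly up_const)

lemma low_power: "low a F \<Longrightarrow> low (n * a) (F ^ n)"
  by (induction n) (auto simp: low_0 intro: low_mult)

lemma up_power: "up a F \<Longrightarrow> up (n * a) (F ^ n)"
  using up_of_nat[of 1] by (induction n) (auto intro: up_mult)

lemma low_prod: "finite A \<Longrightarrow> (\<And>x. x \<in> A \<Longrightarrow> low (n x) (f x)) \<Longrightarrow> low (sum n A) (prod f A)"
  by (induction A rule: finite_induct) (auto simp: low_0 intro!: low_mult)

lemma up_prod: "finite A \<Longrightarrow> (\<And>x. x \<in> A \<Longrightarrow> up (n x) (f x)) \<Longrightarrow> up (sum n A) (prod f A)"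
proof (induction A rule: finite_induct)
  case empty
  then show ?case using up_of_nat[of 1] by simp
qed (auto intro!: up_mult)

text \<open>The translate \<open>F (X + s1, Y + s2)\<close>: first the coefficients are shifted in
  \<open>X\<close>, then the whole in \<open>Y\<close>.\<close>

definition shift2 :: "'r \<Rightarrow> 'r \<Rightarrow> 'r::comm_ring_1 poly poly \<Rightarrow> 'r poly poly" where
  "shift2 s1 s2 F = pcompose (map_poly (\<lambda>p. pcompose p [:s1, 1:]) F) [:[:s2:], 1:]"

lemma hom_shift2: "hom (shift2 s1 s2)"
  unfolding shift2_def[abs_def]
  by (rule hom_comp[OF hom_map_poly[OF hom_pcompose] hom_pcompose])

lemma coeff_pcompose_shift_degree:
  fixes p :: "'r::comm_ring_1 poly"
  assumes "degree p \<le> d"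
  shows "coeff (pcompose p [:s, 1:]) k = (\<Sum>j\<le>d. coeff p j * (of_nat (j choose k) * s ^ (j - k)))"
  using coeff_pcompose_shift[of "coeff p" d s k] poly_as_sum_of_monoms'[OF assms] by simp

text \<open>The shift in \<open>Y\<close> only combines coefficients with constants of the base
  ring, so it commutes with taking the \<open>l\<close>-th Taylor coefficient in
  \<open>X\<close>.\<close>

lemma coeff_shift2:
  assumes "degree F \<le> t"
  shows "coeff (coeff (shift2 s1 s2 F) k) l =
    coeff (pcompose (map_poly (\<lambda>p. coeff (pcompose p [:s1, 1:]) l) F) [:s2, 1:]) k"
proof -
  have "of_nat n * [:s2:] ^ i = [:of_nat n * s2 ^ i:]" for n i
    by (simp add: of_nat_poly poly_const_pow)
  moreover have "degree (map_poly (\<lambda>p. coeff (pcompose p [:s1, 1:]) l) F) \<le> t"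
    "degree (map_poly (\<lambda>p. pcompose p [:s1, 1:]) F) \<le> t"
    using assms by (auto intro: le_trans[OF map_poly_degree_leq])
  ultimately show ?thesis
    unfolding shift2_def
    by (simp add: coeff_pcompose_shift_degree coeff_map_poly coeff_sum mult.commute)
qed

text \<open>The induction step of the general bound, with the leading coefficient \<open>c\<close>
  in \<open>Y\<close> as the leading slice. Total degree gives \<open>t + degree c \<le> d\<close>,
  so the contributions of \<open>t\<close> and of \<open>degree c\<close> fit together.\<close>

theorem schwartz_zippel_bivariate:
  fixes F :: "'r::idom poly poly"
  assumes "F \<noteq> 0" "up d F" "finite S"
    and "\<And>s1 s2. s1 \<in> S \<Longrightarrow> s2 \<in> S \<Longrightarrow> low (\<mu> s1 s2) (shift2 s1 s2 F)"
  shows "(\<Sum>s1\<in>S. \<Sum>s2\<in>S. \<mu> s1 s2) \<le> d * card S"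
proof -
  define t where "t = degree F"
  define c where "c = lead_coeff F"
  have "c \<noteq> 0" using assms(1) by (simp add: c_def)
  have "coeff (coeff F t) (degree c) \<noteq> 0" using \<open>c \<noteq> 0\<close> by (simp add: c_def t_def)
  with assms(2) have d: "t + degree c \<le> d" by (meson up_def not_le)
  define \<nu> where "\<nu> s = (LEAST k. coeff (pcompose c [:s, 1:]) k \<noteq> 0)" for s
  have \<nu>: "coeff (pcompose c [:s, 1:]) (\<nu> s) \<noteq> 0" for s
  proof -
    have "pcompose c [:s, 1:] \<noteq> 0" using \<open>c \<noteq> 0\<close> by (simp add: pcompose_eq_0_iff)
    then show ?thesis unfolding \<nu>_def
      by (metis (mono_tags, lifting) LeastI leading_coeff_neq_0)
  qed
  have sum\<nu>: "sum \<nu> S \<le> card S * 0 + degree c"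
    using \<open>c \<noteq> 0\<close> assms(3) not_less_Least by (intro sum_multiplicity_le) (auto simp: \<nu>_def)
  have "(\<Sum>s2\<in>S. \<mu> s1 s2) \<le> card S * \<nu> s1 + t" if s1: "s1 \<in> S" for s1
  proof -
    define Q where "Q = map_poly (\<lambda>p. coeff (pcompose p [:s1, 1:]) (\<nu> s1)) F"
    show ?thesis
    proof (rule sum_multiplicity_le)
      have "coeff Q t \<noteq> 0" using \<nu>[of s1] by (simp add: Q_def coeff_map_poly t_def c_def)
      then show "Q \<noteq> 0" by auto
      show "degree Q \<le> t" by (simp add: Q_def t_def map_poly_degree_leq)
      fix s2 k assume "s2 \<in> S" "\<nu> s1 + k < \<mu> s1 s2"
      then show "coeff (pcompose Q [:s2, 1:]) k = 0"
        using assms(4)[OF s1, of s2] coeff_shift2[of F t s1 s2 k "\<nu> s1"]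
        by (simp add: low_def Q_def t_def)
    qed (rule assms(3))
  qed
  then have "(\<Sum>s1\<in>S. \<Sum>s2\<in>S. \<mu> s1 s2) \<le> (\<Sum>s1\<in>S. card S * \<nu> s1 + t)" by (rule sum_mono)
  also have "\<dots> = card S * (sum \<nu> S + t)" by (simp add: sum.distrib sum_distrib_left distrib_left)
  also have "\<dots> \<le> card S * d" using sum\<nu> d by (intro mult_le_mono2) simp
  finally show ?thesis by (simp add: mult.commute)
qed

section \<open>Restricting Hasse derivatives to planes\<close>

lemma prod_binomial_eq_0:
  fixes x :: "nat \<Rightarrow> 'r::comm_semiring_1"
  assumes "\<not> (\<forall>i<m. \<gamma> i \<le> \<alpha> i)"
  shows "(\<Prod>i<m. of_nat (\<alpha> i choose \<gamma> i) * x i ^ (\<alpha> i - \<gamma> i)) = 0"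
proof -
  from assms obtain i where "i < m" "\<alpha> i < \<gamma> i" by (auto simp: not_le)
  then show ?thesis by (intro prod_zero bexI[of _ i]) (auto simp: binomial_eq_0)
qed

lemma sum_diff_exponents:
  fixes \<alpha> \<gamma> :: "nat \<Rightarrow> nat"
  assumes "\<forall>i<m. \<gamma> i \<le> \<alpha> i"
  shows "(\<Sum>i<m. \<alpha> i - \<gamma> i) + sum \<gamma> {..<m} = sum \<alpha> {..<m}"
  using assms by (simp add: sum.distrib[symmetric])

text \<open>Each derivative lowers the degree by one, and substituting \<open>A i\<close> of degree
  at most one does not raise it. Only \<open>\<alpha>\<close> above \<open>\<gamma>\<close> survive,
  so the truncated subtraction does no harm.\<close>

lemma up_taylor:
  assumes "\<And>i. i < m \<Longrightarrow> up 1 (A i)"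
    and "\<And>\<alpha>. \<alpha> \<in> expos m d \<Longrightarrow> P \<alpha> \<noteq> 0 \<Longrightarrow> sum \<alpha> {..<m} \<le> D"
  shows "up (D - sum \<gamma> {..<m}) (taylor m d (\<lambda>\<alpha>. [:[:P \<alpha>:]:]) A \<gamma>)"
  unfolding taylor_def
proof (rule up_sum)
  fix \<alpha> assume \<alpha>: "\<alpha> \<in> expos m d"
  let ?t = "[:[:P \<alpha>:]:] * (\<Prod>i<m. of_nat (\<alpha> i choose \<gamma> i) * A i ^ (\<alpha> i - \<gamma> i))"
  show "up (D - sum \<gamma> {..<m}) ?t"
  proof (cases "(\<forall>i<m. \<gamma> i \<le> \<alpha> i) \<and> P \<alpha> \<noteq> 0")
    case False
    then have "(\<Prod>i<m. of_nat (\<alpha> i choose \<gamma> i) * A i ^ (\<alpha> i - \<gamma> i)) = 0 \<or> [:[:P \<alpha>:]:] = 0"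
      using prod_binomial_eq_0[of m \<gamma> \<alpha> A] by auto
    then have "?t = 0" by (elim disjE) (simp_all only: mult_zero_left mult_zero_right)
    then show ?thesis by (simp add: up_def)
  next
    case True
    have "up (0 + (\<alpha> i - \<gamma> i) * 1) (of_nat (\<alpha> i choose \<gamma> i) * A i ^ (\<alpha> i - \<gamma> i))" if "i < m" for i
      using that by (intro up_mult up_of_nat up_power assms(1))
    then have "up (0 + (\<Sum>i<m. 0 + (\<alpha> i - \<gamma> i) * 1)) ?t"
      by (intro up_mult[OF up_const up_prod]) simp_all
    moreover have "(\<Sum>i<m. \<alpha> i - \<gamma> i) \<le> D - sum \<gamma> {..<m}"
      using sum_diff_exponents[of m \<gamma> \<alpha>] True assms(2)[OF \<alpha>] by simp
    ultimately show ?thesis by (auto intro: up_mono)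
  qed
qed

text \<open>At a point of multiplicity \<open>M\<close>, the expansion \<open>taylor_add\<close>
  keeps only \<open>\<beta>\<close> of weight at least \<open>M\<close>; each such term has as many
  factors \<open>V i\<close>, free of constant terms, as the weights of \<open>\<beta>\<close> and
  \<open>\<gamma>\<close> differ.\<close>

lemma low_shifted_taylor:
  assumes "\<And>i. i < m \<Longrightarrow> low 1 (V i)"
    and "\<And>\<beta>. sum \<beta> {..<m} < M \<Longrightarrow> taylor m d P e \<beta> = 0"
  shows "low (M - sum \<gamma> {..<m}) (taylor m d (\<lambda>\<alpha>. [:[:P \<alpha>:]:]) (\<lambda>i. [:[:e i:]:] + V i) \<gamma>)"
  unfolding taylor_add
proof (rule low_sum)
  fix \<beta> assume \<beta>: "\<beta> \<in> expos m d"
  let ?c = "taylor m d (\<lambda>\<alpha>. [:[:P \<alpha>:]:]) (\<lambda>i. [:[:e i:]:]) \<beta>"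
  let ?t = "(\<Prod>i<m. of_nat (\<beta> i choose \<gamma> i) * V i ^ (\<beta> i - \<gamma> i)) * ?c"
  have c: "?c = [:[:taylor m d P e \<beta>:]:]"
    using hom_taylor[OF hom_comp[OF hom_const hom_const]] by metis
  show "low (M - sum \<gamma> {..<m}) ?t"
  proof (cases "(\<forall>i<m. \<gamma> i \<le> \<beta> i) \<and> M \<le> sum \<beta> {..<m}")
    case False
    then have "(\<Prod>i<m. of_nat (\<beta> i choose \<gamma> i) * V i ^ (\<beta> i - \<gamma> i)) = 0 \<or> ?c = 0"
      using prod_binomial_eq_0[of m \<gamma> \<beta> V] assms(2)[of \<beta>] unfolding c by auto
    then have "?t = 0" by (elim disjE) (simp_all only: mult_zero_left mult_zero_right)
    then show ?thesis by (simp add: low_def)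
  next
    case True
    have "low (0 + (\<beta> i - \<gamma> i) * 1) (of_nat (\<beta> i choose \<gamma> i) * V i ^ (\<beta> i - \<gamma> i))" if "i < m" for i
      using that by (intro low_mult low_0 low_power assms(1))
    then have "low ((\<Sum>i<m. 0 + (\<beta> i - \<gamma> i) * 1) + 0) ?t"
      by (intro low_mult[OF low_prod low_0]) simp_all
    moreover have "M - sum \<gamma> {..<m} \<le> (\<Sum>i<m. \<beta> i - \<gamma> i)"
      using sum_diff_exponents[OF conjunct1[OF True]] conjunct2[OF True] by linarith
    ultimately show ?thesis by (auto intro: low_mono)
  qed
qed

text \<open>The substitution \<open>X \<mapsto> T\<close>, \<open>Y \<mapsto> z T\<close>, with \<open>T\<close> the outer and \<open>z\<close> the inner variable of the result.\<close>

definition homogenize :: "'r::comm_ring_1 poly poly \<Rightarrow> 'r poly poly" where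
  "homogenize F = poly (map_poly (map_poly (\<lambda>c. [:c:])) F) [:0, [:0, 1:]:]"

lemma hom_homogenize: "hom homogenize"
  unfolding homogenize_def[abs_def]
  by (rule hom_comp[OF hom_map_poly[OF hom_map_poly[OF hom_const]] hom_poly])

lemma coeff_mult_add:
  assumes "degree p \<le> a" "degree q \<le> b"
  shows "coeff (p * q) (a + b) = coeff p a * coeff q b"
proof -
  have "coeff (p * q) (a + b) = (\<Sum>i\<in>{a}. coeff p i * coeff q (a + b - i))"
    unfolding coeff_mult
  proof (intro sum.mono_neutral_right ballI)
    fix i assume "i \<in> {..a + b} - {a}"
    then consider "a < i" | "b < a + b - i" by fastforce
    then show "coeff p i * coeff q (a + b - i) = 0"
      by cases (use assms in \<open>auto simp: coeff_eq_0\<close>)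
  qed auto
  then show ?thesis by simp
qed

lemma coeff_prod_linear_powers:
  fixes x y :: "nat \<Rightarrow> 'r::comm_ring_1"
  shows "degree (\<Prod>i<m. [:x i, y i:] ^ n i) \<le> sum n {..<m} \<and>
    coeff (\<Prod>i<m. [:x i, y i:] ^ n i) (sum n {..<m}) = (\<Prod>i<m. y i ^ n i)"
proof (induction m)
  case (Suc m)
  have deg: "degree ([:x m, y m:] ^ n m) \<le> n m"
    by (rule le_trans[OF degree_power_le]) (auto simp: degree_pCons_le)
  have "coeff ([:x m, y m:] ^ n m) (n m) = y m ^ n m"
    by (simp add: coeff_linear_poly_power)
  then show ?case using Suc deg
    by (auto simp: coeff_mult_add intro: le_trans[OF degree_mult_le])
qed simp

text \<open>On the plane \<open>a + X b1 + Y b2\<close> the \<open>\<gamma>\<close>-th Hasse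
  derivative has too many zeros, counted with multiplicity, for its total degree, so it is the zero
  polynomial in \<open>X\<close> and \<open>Y\<close>. Its part of top degree is the derivative of
  the top form at \<open>b1 + z b2\<close>, which vanishes with it.\<close>

lemma top_form_vanishes:
  fixes P :: "(nat \<Rightarrow> nat) \<Rightarrow> 'a::{finite,field}"
  assumes deg: "\<And>\<alpha>. \<alpha> \<in> expos m d \<Longrightarrow> P \<alpha> \<noteq> 0 \<Longrightarrow> sum \<alpha> {..<m} \<le> D"
    and van: "\<And>e \<beta>. e \<in> E \<Longrightarrow> sum \<beta> {..<m} < M \<Longrightarrow> taylor m d P e \<beta> = 0"
    and many: "(D - sum \<gamma> {..<m}) * card (UNIV :: 'a set) <
      (M - sum \<gamma> {..<m}) * card {(s1, s2). (\<lambda>i. a i + s1 * b1 i + s2 * b2 i) \<in> E}"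
  shows "taylor m d (\<lambda>\<alpha>. [:if sum \<alpha> {..<m} = D then P \<alpha> else 0:]) (\<lambda>i. [:b1 i, b2 i:]) \<gamma> = 0"
proof (cases "sum \<gamma> {..<m} \<le> D")
  case False
  \<comment> \<open>A monomial of degree \<open>D\<close> cannot lie above a \<open>\<gamma>\<close>
    of larger weight, so no term survives.\<close>
  have "[:if sum \<alpha> {..<m} = D then P \<alpha> else 0:]
      * (\<Prod>i<m. of_nat (\<alpha> i choose \<gamma> i) * [:b1 i, b2 i:] ^ (\<alpha> i - \<gamma> i)) = 0" for \<alpha>
  proof (cases "\<forall>i<m. \<gamma> i \<le> \<alpha> i")
    case True
    then show ?thesis using sum_diff_exponents[OF True] False by simp
  next
    case False
    show ?thesis using prod_binomial_eq_0[OF False, of "\<lambda>i. [:b1 i, b2 i:]"] by (simp only: mult_zero_right)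
  qed
  then show ?thesis unfolding taylor_def by (intro sum.neutral) blast
next
  case g: True
  define A where "A i = [:[:a i, b1 i:], [:b2 i:]:]" for i
  define F where "F = taylor m d (\<lambda>\<alpha>. [:[:P \<alpha>:]:]) A \<gamma>"
  let ?g = "sum \<gamma> {..<m}"
  have "F = 0"
  proof (rule ccontr)
    assume "F \<noteq> 0"
    define \<mu> where "\<mu> s1 s2 = (if (\<lambda>i. a i + s1 * b1 i + s2 * b2 i) \<in> E then M - ?g else 0)" for s1 s2
    have "up (D - ?g) F"
      unfolding F_def using deg
      by (intro up_taylor) (auto simp: A_def up_def coeff_pCons split: nat.splits)
    moreover have "low (\<mu> s1 s2) (shift2 s1 s2 F)" for s1 s2
    proof (cases "(\<lambda>i. a i + s1 * b1 i + s2 * b2 i) \<in> E")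
      case True
      have "shift2 s1 s2 [:[:c:]:] = [:[:c:]:]" for c :: 'a
        by (simp add: shift2_def map_poly_pCons)
      moreover have "shift2 s1 s2 (A i) =
          [:[:a i + s1 * b1 i + s2 * b2 i:]:] + [:[:0, b1 i:], [:b2 i:]:]" for i
        by (simp add: shift2_def A_def map_poly_pCons pcompose_pCons mult.commute)
      ultimately have "shift2 s1 s2 F = taylor m d (\<lambda>\<alpha>. [:[:P \<alpha>:]:])
          (\<lambda>i. [:[:a i + s1 * b1 i + s2 * b2 i:]:] + [:[:0, b1 i:], [:b2 i:]:]) \<gamma>"
        unfolding F_def hom_taylor[OF hom_shift2] by simp
      moreover have "low (M - ?g) \<dots>"
        using van[OF True]
        by (intro low_shifted_taylor) (auto simp: low_def)
      ultimately show ?thesis using True by (simp add: \<mu>_def)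
    qed (simp add: \<mu>_def low_0)
    ultimately have "(\<Sum>s1\<in>UNIV. \<Sum>s2\<in>UNIV. \<mu> s1 s2) \<le> (D - ?g) * card (UNIV :: 'a set)"
      using \<open>F \<noteq> 0\<close> by (intro schwartz_zippel_bivariate) auto
    moreover have "(\<Sum>s1\<in>UNIV. \<Sum>s2\<in>UNIV. \<mu> s1 s2) =
        (M - ?g) * card {(s1, s2). (\<lambda>i. a i + s1 * b1 i + s2 * b2 i) \<in> E}"
    proof -
      have "(\<Sum>s1\<in>UNIV. \<Sum>s2\<in>UNIV. \<mu> s1 s2) = (\<Sum>s\<in>UNIV. if (\<lambda>i. a i + fst s * b1 i + snd s * b2 i) \<in> E then M - ?g else 0)"
        by (simp add: sum.cartesian_product \<mu>_def case_prod_unfold)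
      also have "\<dots> = (M - ?g) * card {s. (\<lambda>i. a i + fst s * b1 i + snd s * b2 i) \<in> E}"
        by (subst sum.If_cases) (auto simp: mult.commute)
      finally show ?thesis by (simp add: case_prod_unfold)
    qed
    ultimately show False using many by simp
  qed
  have "homogenize [:[:c:]:] = [:[:c:]:]" for c :: 'a
    by (simp add: homogenize_def map_poly_pCons)
  \<comment> \<open>The coordinate becomes \<open>a i + (b1 i + z * b2 i) * T\<close>: the highest
    power of \<open>T\<close> sees the direction and forgets \<open>a\<close>.\<close>
  moreover have "homogenize (A i) = [:[:a i:], [:b1 i, b2 i:]:]" for i
    by (simp add: homogenize_def A_def map_poly_pCons)
  ultimately have "homogenize F = taylor m d (\<lambda>\<alpha>. [:[:P \<alpha>:]:]) (\<lambda>i. [:[:a i:], [:b1 i, b2 i:]:]) \<gamma>"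
    unfolding F_def hom_taylor[OF hom_homogenize] by simp
  then have "0 = coeff (taylor m d (\<lambda>\<alpha>. [:[:P \<alpha>:]:]) (\<lambda>i. [:[:a i:], [:b1 i, b2 i:]:]) \<gamma>) (D - ?g)"
    using \<open>F = 0\<close> hom_0[OF hom_homogenize] by (metis coeff_0)
  also have "\<dots> = taylor m d (\<lambda>\<alpha>. [:if sum \<alpha> {..<m} = D then P \<alpha> else 0:]) (\<lambda>i. [:b1 i, b2 i:]) \<gamma>"
    unfolding taylor_def coeff_sum
  proof (rule sum.cong)
    fix \<alpha> assume \<alpha>: "\<alpha> \<in> expos m d"
    let ?x = "\<lambda>i. [:[:a i:], [:b1 i, b2 i:]:]"
    define n where "n i = \<alpha> i - \<gamma> i" for i
    define C :: "'a poly" where "C = (\<Prod>i<m. of_nat (\<alpha> i choose \<gamma> i))"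
    have l: "coeff ([:[:P \<alpha>:]:] * (\<Prod>i<m. of_nat (\<alpha> i choose \<gamma> i) * ?x i ^ n i)) k
        = [:P \<alpha>:] * (C * coeff (\<Prod>i<m. ?x i ^ n i) k)" for k
    proof -
      have "(\<Prod>i<m. of_nat (\<alpha> i choose \<gamma> i)) = [:C:]"
        unfolding C_def hom_prod[OF hom_const] by (simp add: of_nat_poly)
      then show ?thesis by (simp add: prod.distrib)
    qed
    show "coeff ([:[:P \<alpha>:]:] * (\<Prod>i<m. of_nat (\<alpha> i choose \<gamma> i) * ?x i ^ (\<alpha> i - \<gamma> i))) (D - ?g)
      = [:if sum \<alpha> {..<m} = D then P \<alpha> else 0:] *
        (\<Prod>i<m. of_nat (\<alpha> i choose \<gamma> i) * [:b1 i, b2 i:] ^ (\<alpha> i - \<gamma> i))"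
      unfolding n_def[symmetric] unfolding l unfolding prod.distrib C_def[symmetric]
    proof (cases "P \<alpha> \<noteq> 0 \<and> (\<forall>i<m. \<gamma> i \<le> \<alpha> i)")
      case False
      have "C = 0" if "\<not> (\<forall>i<m. \<gamma> i \<le> \<alpha> i)"
        using prod_binomial_eq_0[OF that, of "\<lambda>_. 1"] by (simp only: C_def power_one mult_1_right)
      with False have "C = 0 \<or> [:P \<alpha>:] = 0 \<and> [:if sum \<alpha> {..<m} = D then P \<alpha> else 0:] = 0" by auto
      then show "[:P \<alpha>:] * (C * coeff (\<Prod>i<m. ?x i ^ n i) (D - ?g)) =
        [:if sum \<alpha> {..<m} = D then P \<alpha> else 0:] * (C * (\<Prod>i<m. [:b1 i, b2 i:] ^ n i))"
        by (elim disjE conjE) (simp_all only: mult_zero_left mult_zero_right)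
    next
      case True
      then have n: "sum n {..<m} + ?g = sum \<alpha> {..<m}"
        unfolding n_def by (intro sum_diff_exponents) simp
      have le: "sum \<alpha> {..<m} \<le> D" using True deg[OF \<alpha>] by simp
      \<comment> \<open>A monomial of degree below \<open>D\<close> does not reach the power
        \<open>D - ?g\<close> of \<open>T\<close>; one of degree \<open>D\<close> contributes its
        leading coefficient, as \<open>c1\<close> shows.\<close>
      have c0: "coeff (\<Prod>i<m. ?x i ^ n i) (D - ?g) = 0" if "sum \<alpha> {..<m} < D"
        using coeff_prod_linear_powers[where n=n and m=m and x="\<lambda>i. [:a i:]" and y="\<lambda>i. [:b1 i, b2 i:]"] n that
        by (intro coeff_eq_0) auto
      have c1: "coeff (\<Prod>i<m. ?x i ^ n i) (D - ?g) = (\<Prod>i<m. [:b1 i, b2 i:] ^ n i)" if "sum \<alpha> {..<m} = D"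
      proof -
        have "D - ?g = sum n {..<m}" using n that by simp
        then show ?thesis
          using coeff_prod_linear_powers[where n=n and m=m and x="\<lambda>i. [:a i:]" and y="\<lambda>i. [:b1 i, b2 i:]"]
          by simp
      qed
      show "[:P \<alpha>:] * (C * coeff (\<Prod>i<m. ?x i ^ n i) (D - ?g)) =
        [:if sum \<alpha> {..<m} = D then P \<alpha> else 0:] * (C * (\<Prod>i<m. [:b1 i, b2 i:] ^ n i))"
      proof (cases "sum \<alpha> {..<m} = D")
        case True
        then show ?thesis by (simp only: c1 simp_thms if_True)
      next
        case False
        then have "sum \<alpha> {..<m} < D" using le by simp
        then show ?thesis by (simp only: c0 False if_False pCons_0_0 mult_zero_left mult_zero_right)
      qed
    qed
  qed simp
  finally show ?thesis by simp
qed

section \<open>Kakeya sets of planes\<close>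

lemma taylor_diff: "taylor m d (\<lambda>\<alpha>. P \<alpha> - Q \<alpha>) a \<beta> = taylor m d P a \<beta> - taylor m d Q a \<beta>"
  by (simp add: taylor_def left_diff_distrib sum_subtractf)

text \<open>Pigeonhole: there are more coefficient families than possible Taylor data on
  \<open>E\<close>, so two families share their data, and their difference vanishes to order
  \<open>M\<close>.\<close>

lemma exists_vanishing_polynomial:
  fixes E :: "(nat \<Rightarrow> 'a::{finite,field}) set"
  assumes "finite E" "card E * card (expos m (M - 1)) < card (expos m d)"
  obtains P :: "(nat \<Rightarrow> nat) \<Rightarrow> 'a" and \<alpha> where "\<alpha> \<in> expos m d" "P \<alpha> \<noteq> 0"
    "\<And>e \<beta>. e \<in> E \<Longrightarrow> sum \<beta> {..<m} < M \<Longrightarrow> taylor m d P e \<beta> = 0"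
proof -
  let ?q = "card (UNIV :: 'a set)"
  define C where "C = E \<times> expos m (M - 1)"
  define coefs where "coefs = (expos m d \<rightarrow>\<^sub>E (UNIV :: 'a set))"
  define ev where "ev P = restrict (\<lambda>(e, \<beta>). taylor m d P e \<beta>) C" for P :: "(nat \<Rightarrow> nat) \<Rightarrow> 'a"
  have "finite C" using assms(1) by (simp add: C_def)
  have q: "1 < ?q" using card_mono[of UNIV "{0, 1 :: 'a}"] by simp
  have "\<not> inj_on ev coefs"
  proof
    assume "inj_on ev coefs"
    moreover have "ev ` coefs \<subseteq> (C \<rightarrow>\<^sub>E UNIV)" by (auto simp: ev_def)
    moreover have "finite (C \<rightarrow>\<^sub>E (UNIV :: 'a set))" using \<open>finite C\<close> by (intro finite_PiE) auto
    ultimately have "card coefs \<le> card (C \<rightarrow>\<^sub>E (UNIV :: 'a set))" by (rule card_inj_on_le)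
    then have "?q ^ card (expos m d) \<le> ?q ^ card C"
      using \<open>finite C\<close> by (simp add: coefs_def card_PiE)
    moreover have "card C < card (expos m d)" using assms by (simp add: C_def card_cartesian_product)
    ultimately show False using q by (simp add: power_increasing_iff)
  qed
  then obtain P Q where PQ: "P \<in> coefs" "Q \<in> coefs" "P \<noteq> Q" "ev P = ev Q" by (auto simp: inj_on_def)
  then obtain \<alpha> where "\<alpha> \<in> expos m d" "P \<alpha> \<noteq> Q \<alpha>"
    unfolding coefs_def by (metis PiE_ext)
  moreover have "taylor m d (\<lambda>\<alpha>. P \<alpha> - Q \<alpha>) e \<beta> = 0" if "e \<in> E" "sum \<beta> {..<m} < M" for e \<beta>
  proof -
    \<comment> \<open>\<open>\<beta>\<close> is arbitrary beyond the first \<open>m\<close> entries,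
      which \<open>taylor\<close> does not read; the cut-off version lies in the index set.\<close>
    define \<gamma> where "\<gamma> i = (if i < m then \<beta> i else 0)" for i
    have "(e, \<gamma>) \<in> C" using that by (auto simp: C_def expos_def \<gamma>_def)
    then have "taylor m d P e \<gamma> = taylor m d Q e \<gamma>"
      using fun_cong[OF PQ(4), of "(e, \<gamma>)"] by (simp add: ev_def)
    moreover have "taylor m d R e \<gamma> = taylor m d R e \<beta>" for R
      by (rule taylor_cong) (auto simp: \<gamma>_def)
    ultimately show ?thesis by (simp add: taylor_diff)
  qed
  ultimately show ?thesis using that[of \<alpha> "\<lambda>\<alpha>. P \<alpha> - Q \<alpha>"] by auto
qed

text \<open>If \<open>E\<close> were too small, a nonzero polynomial of degree at most
  \<open>d\<close> would vanish on it to order \<open>M\<close>. Its top form then vanishes to order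
  \<open>l\<close> at \<open>b1 + z b2\<close> for all pairs in \<open>D\<close>, and
  Schwartz-Zippel on a grid of side \<open>q ^ 2\<close> contradicts \<open>many\<close>.\<close>

theorem kakeya_planes:
  fixes E :: "(nat \<Rightarrow> 'a::{finite,field}) set"
  assumes "finite E" "D \<subseteq> grid m (\<lambda>_. UNIV) \<times> grid m (\<lambda>_. UNIV)"
    and planes: "\<And>b1 b2 g. (b1, b2) \<in> D \<Longrightarrow> g < l \<Longrightarrow> \<exists>a. (d - g) * card (UNIV :: 'a set)
      < (M - g) * card {(s1, s2). (\<lambda>i. a i + s1 * b1 i + s2 * b2 i) \<in> E}"
    and many: "d * card (UNIV :: 'a set) ^ (2 * m) < card (UNIV :: 'a set) ^ 2 * (l * card D)"
  shows "(d + m) choose m \<le> card E * ((M - 1 + m) choose m)"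
proof (rule ccontr)
  let ?q = "card (UNIV :: 'a set)"
  assume "\<not> ?thesis"
  then have lt: "card E * card (expos m (M - 1)) < card (expos m d)" by (simp add: card_expos)
  show False
  proof (rule exists_vanishing_polynomial[OF assms(1) lt])
    fix P :: "(nat \<Rightarrow> nat) \<Rightarrow> 'a" and \<alpha>
    assume \<alpha>: "\<alpha> \<in> expos m d" "P \<alpha> \<noteq> 0"
      and van: "\<And>e \<beta>. e \<in> E \<Longrightarrow> sum \<beta> {..<m} < M \<Longrightarrow> taylor m d P e \<beta> = 0"
    define supp where "supp = {\<alpha> \<in> expos m d. P \<alpha> \<noteq> 0}"
    define k where "k = Max ((\<lambda>\<alpha>. sum \<alpha> {..<m}) ` supp)"
    have fin: "finite supp" and ne: "supp \<noteq> {}" using \<alpha> by (auto simp: supp_def)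
    have kmax: "sum \<beta> {..<m} \<le> k" if "\<beta> \<in> expos m d" "P \<beta> \<noteq> 0" for \<beta>
      using that fin unfolding k_def by (intro Max_ge) (auto simp: supp_def)
    have "k \<in> (\<lambda>\<alpha>. sum \<alpha> {..<m}) ` supp" unfolding k_def using fin ne by (intro Max_in) auto
    then obtain \<beta> where \<beta>: "\<beta> \<in> expos m d" "P \<beta> \<noteq> 0" "sum \<beta> {..<m} = k" by (auto simp: supp_def)
    then have "k \<le> d" by (auto simp: expos_def)
    \<comment> \<open>The \<open>q ^ 2\<close> polynomials \<open>x + y z\<close> form the side of
      the grid; \<open>B\<close> embeds the pairs of directions into it.\<close>
    define S where "S = range (\<lambda>(x, y). [:x, y :: 'a:])"
    have "inj (\<lambda>(x, y). [:x, y :: 'a:])" by (auto simp: inj_on_def)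
    then have cS: "card S = ?q ^ 2" unfolding S_def
      by (subst card_image) (simp_all add: card_cartesian_product power2_eq_square flip: UNIV_Times_UNIV)
    define B where "B = (\<lambda>(b1, b2) (i::nat). [:b1 i, b2 i :: 'a:])"
    have "inj B" by (auto simp: B_def inj_on_def fun_eq_iff)
    have BD: "B ` D \<subseteq> grid m (\<lambda>_. S)"
      using assms(2) by (force simp: B_def S_def grid_def)
    define \<mu> where "\<mu> x = (if x \<in> B ` D then l else 0)" for x
    have "finite S" by (simp add: S_def)
    have "card S * sum \<mu> (grid m (\<lambda>_. S)) \<le> d * card S ^ m"
    proof (rule schwartz_zippel_multiplicity[where P = "\<lambda>\<alpha>. [:if sum \<alpha> {..<m} = k then P \<alpha> else 0:]"])
      show "finite S" "S \<noteq> {}" by (auto simp: S_def)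
      show "\<beta> \<in> expos m d" "[:if sum \<beta> {..<m} = k then P \<beta> else 0:] \<noteq> 0" using \<beta> by auto
      fix x \<gamma> assume "x \<in> grid m (\<lambda>_. S)" and \<gamma>: "sum \<gamma> {..<m} < \<mu> x"
      then have "x \<in> B ` D" "sum \<gamma> {..<m} < l" by (auto simp: \<mu>_def split: if_splits)
      then obtain b1 b2 where b: "(b1, b2) \<in> D" "x = (\<lambda>i. [:b1 i, b2 i:])" by (auto simp: B_def)
      obtain a where a: "(d - sum \<gamma> {..<m}) * ?q
          < (M - sum \<gamma> {..<m}) * card {(s1, s2). (\<lambda>i. a i + s1 * b1 i + s2 * b2 i) \<in> E}"
        using planes[OF b(1) \<open>sum \<gamma> {..<m} < l\<close>] by auto
      have "(k - sum \<gamma> {..<m}) * ?q \<le> (d - sum \<gamma> {..<m}) * ?q"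
        using \<open>k \<le> d\<close> by (intro mult_le_mono1) simp
      with a show "taylor m d (\<lambda>\<alpha>. [:if sum \<alpha> {..<m} = k then P \<alpha> else 0:]) x \<gamma> = 0"
        unfolding b(2) by (intro top_form_vanishes[OF kmax van le_less_trans])
    qed
    moreover have "sum \<mu> (grid m (\<lambda>_. S)) = l * card D"
    proof -
      have "sum \<mu> (grid m (\<lambda>_. S)) = sum \<mu> (B ` D)"
        using BD \<open>finite S\<close> by (intro sum.mono_neutral_right finite_grid) (auto simp: \<mu>_def)
      also have "\<dots> = l * card D"
        using card_image[OF inj_on_subset[OF \<open>inj B\<close>], of D] by (simp add: \<mu>_def)
      finally show ?thesis .
    qed
    ultimately show False using many by (simp add: cS power_mult)
  qed
qed

section \<open>Fibres of random matrices\<close>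

lemma vecs_eq_grid: "vecs n = grid n (\<lambda>_. UNIV)"
  by (auto simp: vecs_def grid_def)

lemma finite_vecs [simp]: "finite (vecs n :: (nat \<Rightarrow> 'a::{finite,zero}) set)"
  by (simp add: vecs_eq_grid finite_grid)

lemma card_vecs: "card (vecs n :: (nat \<Rightarrow> 'a::{finite,zero}) set) = card (UNIV :: 'a set) ^ n"
  by (simp add: vecs_eq_grid card_grid)

lemma finite_mats [simp]: "finite (mats k n :: (nat \<Rightarrow> nat \<Rightarrow> 'a::{finite,zero}) set)"
proof (rule finite_imageD)
  let ?f = "\<lambda>M :: nat \<Rightarrow> nat \<Rightarrow> 'a. restrict (\<lambda>(i, j). M i j) ({..<k} \<times> {..<n})"
  have "?f ` mats k n \<subseteq> ({..<k} \<times> {..<n}) \<rightarrow>\<^sub>E UNIV"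
    by (auto simp: PiE_def extensional_def)
  then show "finite (?f ` mats k n)" by (rule finite_subset) (auto intro!: finite_PiE)
  show "inj_on ?f (mats k n)"
  proof (rule inj_onI, intro ext)
    fix M N :: "nat \<Rightarrow> nat \<Rightarrow> 'a" and i j
    assume *: "M \<in> mats k n" "N \<in> mats k n" "?f M = ?f N"
    show "M i j = N i j"
      using fun_cong[OF *(3), of "(i, j)"] *(1,2)
      by (cases "i < k \<and> j < n") (auto simp: mats_def)
  qed
qed

lemma apply_mat_in_vecs [simp]: "apply_mat k n M x \<in> vecs k"
  by (simp add: apply_mat_def vecs_def)

lemma zero_mat_in_mats: "(\<lambda>_ _. 0) \<in> mats k n"
  by (simp add: mats_def)

lemma apply_mat_diff:
  fixes x y :: "nat \<Rightarrow> 'a::comm_ring"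
  shows "apply_mat k n M (\<lambda>i. x i - y i) = (\<lambda>i. apply_mat k n M x i - apply_mat k n M y i)"
  by (auto simp: apply_mat_def fun_eq_iff right_diff_distrib sum_subtractf)

text \<open>With \<open>z = x - y\<close> and \<open>z j \<noteq> 0\<close>, adding
  \<open>u i / z j\<close> to column \<open>j\<close> adds \<open>u\<close> to the image of
  \<open>z\<close>, so all values at \<open>z\<close> are equally frequent. This is the share of
  pairwise independence that second moments use.\<close>

lemma card_mats_collision:
  fixes x y :: "nat \<Rightarrow> 'a::{finite,field}"
  assumes "x \<in> vecs n" "y \<in> vecs n" "x \<noteq> y"
  shows "card {M \<in> mats k n. apply_mat k n M x = apply_mat k n M y} * card (UNIV :: 'a set) ^ k
    = card (mats k n :: (nat \<Rightarrow> nat \<Rightarrow> 'a) set)"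
proof -
  define z where "z = (\<lambda>i. x i - y i)"
  obtain j where "x j \<noteq> y j" using assms(3) by auto
  then have j: "z j \<noteq> 0" "j < n" using assms(1,2) by (auto simp: z_def vecs_def) (metis not_le)
  define A where "A u = {M \<in> mats k n. apply_mat k n M z = u}" for u :: "nat \<Rightarrow> 'a"
  define shift where "shift u M = (\<lambda>i l. if l = j then M i l + u i / z j else M i l)"
    for u :: "nat \<Rightarrow> 'a" and M
  have shift: "apply_mat k n (shift u M) z = (\<lambda>i. apply_mat k n M z i + u i)" if "u \<in> vecs k" for u M
  proof
    fix i
    show "apply_mat k n (shift u M) z i = apply_mat k n M z i + u i"
    proof (cases "i < k")
      case True
      have "(\<Sum>l<n. shift u M i l * z l) = (\<Sum>l<n. M i l * z l + (if l = j then u i else 0))"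
        using j by (intro sum.cong) (auto simp: shift_def field_simps)
      then show ?thesis using True j by (simp add: apply_mat_def sum.distrib)
    qed (use that in \<open>auto simp: apply_mat_def vecs_def\<close>)
  qed
  have cA: "card (A u) = card (A (\<lambda>_. 0))" if u: "u \<in> vecs k" for u
  proof (rule bij_betw_same_card[symmetric], rule bij_betw_byWitness[where f' = "shift (\<lambda>i. - u i)"])
    have u': "(\<lambda>i. - u i) \<in> vecs k" using u by (simp add: vecs_def)
    have mem: "shift v M \<in> mats k n" if "M \<in> mats k n" "v \<in> vecs k" for v M
      using that j(2) by (auto simp: shift_def mats_def vecs_def)
    show "\<forall>M\<in>A (\<lambda>_. 0). shift (\<lambda>i. - u i) (shift u M) = M" "\<forall>M\<in>A u. shift u (shift (\<lambda>i. - u i) M) = M"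
      by (auto simp: shift_def fun_eq_iff)
    show "shift u ` A (\<lambda>_. 0) \<subseteq> A u" "shift (\<lambda>i. - u i) ` A u \<subseteq> A (\<lambda>_. 0)"
      using mem u u' by (auto simp: A_def shift)
  qed
  have "mats k n = (\<Union>u\<in>vecs k. A u)" by (auto simp: A_def)
  then have "card (mats k n :: (nat \<Rightarrow> nat \<Rightarrow> 'a) set) = card (\<Union>u\<in>vecs k. A u)" by simp
  also have "\<dots> = (\<Sum>u\<in>vecs k. card (A u))"
    by (rule card_UN_disjoint) (auto simp: A_def)
  also have "\<dots> = card (A (\<lambda>_. 0)) * card (UNIV :: 'a set) ^ k"
    using cA by (simp add: card_vecs)
  also have "A (\<lambda>_. 0) = {M \<in> mats k n. apply_mat k n M x = apply_mat k n M y}"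
    by (auto simp: A_def z_def apply_mat_diff fun_eq_iff)
  finally show ?thesis ..
qed

definition fiber :: "(nat \<Rightarrow> 'a::comm_semiring_0) set \<Rightarrow> nat \<Rightarrow> nat \<Rightarrow> (nat \<Rightarrow> nat \<Rightarrow> 'a) \<Rightarrow> (nat \<Rightarrow> 'a) \<Rightarrow> (nat \<Rightarrow> 'a) set" where
  "fiber T k n M u = {x \<in> T. apply_mat k n M x = u}"

lemma sum_card_fiber:
  fixes T :: "(nat \<Rightarrow> 'a::{finite,comm_semiring_0}) set"
  assumes "finite T"
  shows "(\<Sum>u\<in>vecs k. card (fiber T k n M u)) = card T"
proof -
  have "T = (\<Union>u\<in>vecs k. fiber T k n M u)" by (auto simp: fiber_def)
  moreover have "card (\<Union>u\<in>vecs k. fiber T k n M u) = (\<Sum>u\<in>vecs k. card (fiber T k n M u))"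
    using assms by (intro card_UN_disjoint) (auto simp: fiber_def)
  ultimately show ?thesis by simp
qed

lemma sum_card_fiber_square:
  fixes T :: "(nat \<Rightarrow> 'a::{finite,comm_semiring_0}) set"
  assumes "finite T"
  shows "(\<Sum>u\<in>vecs k. card (fiber T k n M u) ^ 2)
    = (\<Sum>x\<in>T. \<Sum>y\<in>T. if apply_mat k n M x = apply_mat k n M y then 1 else 0)"
proof -
  let ?p = "{(x, y). x \<in> T \<and> y \<in> T \<and> apply_mat k n M x = apply_mat k n M y}"
  have "?p = (\<Union>u\<in>vecs k. fiber T k n M u \<times> fiber T k n M u)" by (auto simp: fiber_def)
  moreover have "card (\<Union>u\<in>vecs k. fiber T k n M u \<times> fiber T k n M u)
      = (\<Sum>u\<in>vecs k. card (fiber T k n M u \<times> fiber T k n M u))"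
    using assms by (intro card_UN_disjoint) (auto simp: fiber_def)
  ultimately have "(\<Sum>u\<in>vecs k. card (fiber T k n M u) ^ 2) = card ?p"
    by (simp add: card_cartesian_product power2_eq_square)
  also have "\<dots> = (\<Sum>z\<in>T \<times> T. if apply_mat k n M (fst z) = apply_mat k n M (snd z) then 1 else 0)"
    using assms by (subst sum.inter_filter[symmetric]) (auto intro!: arg_cong[of _ _ card])
  also have "\<dots> = (\<Sum>x\<in>T. \<Sum>y\<in>T. if apply_mat k n M x = apply_mat k n M y then 1 else 0)"
    by (simp add: sum.cartesian_product case_prod_unfold)
  finally show ?thesis .
qed

text \<open>Expanding the square leaves a count of colliding pairs. Pairs of distinct points
  contribute just the squared mean, so only the diagonal remains.\<close>

lemma fiber_variance:
  fixes T :: "(nat \<Rightarrow> 'a::{finite,field}) set"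
  assumes T: "T \<subseteq> vecs n"
  shows "(\<Sum>M\<in>mats k n. \<Sum>u\<in>vecs k. (real (card (fiber T k n M u)) - real (card T) / real (card (UNIV :: 'a set)) ^ k)\<^sup>2)
    \<le> real (card (mats k n :: (nat \<Rightarrow> nat \<Rightarrow> 'a) set)) * real (card T)"
proof -
  let ?q = "card (UNIV :: 'a set)" and ?X = "mats k n :: (nat \<Rightarrow> nat \<Rightarrow> 'a) set"
  have finT: "finite T" using finite_subset[OF T] by simp
  have q: "real ?q ^ k > 0" by (simp add: card_gt_0_iff)
  define c where "c = real (card T) / real ?q ^ k"
  have cq: "c * real ?q ^ k = real (card T)" using q by (simp add: c_def)
  have one: "(\<Sum>u\<in>vecs k. (real (card (fiber T k n M u)) - c)\<^sup>2)
     = (\<Sum>x\<in>T. \<Sum>y\<in>T. if apply_mat k n M x = apply_mat k n M y then 1 else 0) - c * real (card T)"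
    for M :: "nat \<Rightarrow> nat \<Rightarrow> 'a"
  proof -
    let ?f = "\<lambda>u. real (card (fiber T k n M u))"
    have "(\<Sum>u\<in>vecs k. (?f u - c)\<^sup>2) = (\<Sum>u\<in>vecs k. (?f u)\<^sup>2 - 2 * c * ?f u + c * c)"
      by (intro sum.cong refl) (simp add: power2_eq_square algebra_simps)
    also have "\<dots> = (\<Sum>u\<in>vecs k. (?f u)\<^sup>2) - 2 * c * (\<Sum>u\<in>vecs k. ?f u) + real ?q ^ k * (c * c)"
      by (simp add: sum.distrib sum_subtractf sum_distrib_left card_vecs)
    also have "(\<Sum>u\<in>vecs k. ?f u) = real (card T)"
      using sum_card_fiber[OF finT, of k n M] by (simp flip: of_nat_sum)
    also have "(\<Sum>u\<in>vecs k. (?f u)\<^sup>2) = real (\<Sum>u\<in>vecs k. (card (fiber T k n M u))\<^sup>2)" by simp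
    also have "real ?q ^ k * (c * c) = c * real (card T)" using cq by (simp add: mult_ac)
    finally show ?thesis unfolding sum_card_fiber_square[OF finT] by (simp add: if_distrib cong: if_cong)
  qed
  \<comment> \<open>On the diagonal the second summand is surplus; keeping it makes the main term
    equal for all pairs, so that it cancels exactly.\<close>
  have pair: "(\<Sum>M\<in>?X. if apply_mat k n M x = apply_mat k n M y then 1 else 0)
      \<le> (if x = y then real (card ?X) else 0) + real (card ?X) / real ?q ^ k" if "x \<in> T" "y \<in> T" for x y
  proof (cases "x = y")
    case False
    have "real (card {M \<in> ?X. apply_mat k n M x = apply_mat k n M y}) * real ?q ^ k = real (card ?X)"
      using card_mats_collision[of x n y k] False that T by (simp flip: of_nat_power of_nat_mult) blast
    moreover have "(\<Sum>M\<in>?X. if apply_mat k n M x = apply_mat k n M y then 1 else 0)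
      = real (card {M \<in> ?X. apply_mat k n M x = apply_mat k n M y})"
      by (subst sum.inter_filter[symmetric]) auto
    ultimately show ?thesis using q False by (simp add: field_simps)
  qed simp
  have "(\<Sum>M\<in>?X. \<Sum>u\<in>vecs k. (real (card (fiber T k n M u)) - c)\<^sup>2)
    = (\<Sum>x\<in>T. \<Sum>y\<in>T. \<Sum>M\<in>?X. if apply_mat k n M x = apply_mat k n M y then 1 else 0) - real (card ?X) * (c * real (card T))"
  proof -
    have "(\<Sum>M\<in>?X. \<Sum>x\<in>T. \<Sum>y\<in>T. if apply_mat k n M x = apply_mat k n M y then 1 else 0)
      = (\<Sum>x\<in>T. \<Sum>M\<in>?X. \<Sum>y\<in>T. if apply_mat k n M x = apply_mat k n M y then 1 else (0::real))"
      by (rule sum.swap)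
    also have "\<dots> = (\<Sum>x\<in>T. \<Sum>y\<in>T. \<Sum>M\<in>?X. if apply_mat k n M x = apply_mat k n M y then 1 else 0)"
      by (intro sum.cong refl sum.swap)
    finally show ?thesis unfolding one by (simp add: sum_subtractf)
  qed
  also have "\<dots> \<le> (\<Sum>x\<in>T. \<Sum>y\<in>T. (if x = y then real (card ?X) else 0) + real (card ?X) / real ?q ^ k)
      - real (card ?X) * (c * real (card T))"
    by (intro diff_right_mono sum_mono pair)
  also have "(\<Sum>x\<in>T. \<Sum>y\<in>T. (if x = y then real (card ?X) else 0) + real (card ?X) / real ?q ^ k)
      = real (card ?X) * real (card T) + real (card ?X) * (c * real (card T))"
    using finT by (simp add: sum.distrib c_def distrib_left mult_ac)
  finally show ?thesis by (simp add: c_def)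
qed

lemma markov_card:
  fixes f :: "'b \<Rightarrow> real"
  assumes "finite X" "\<And>x. x \<in> X \<Longrightarrow> 0 \<le> f x"
  shows "a * real (card {x \<in> X. a \<le> f x}) \<le> sum f X"
proof -
  have "a * real (card {x \<in> X. a \<le> f x}) = (\<Sum>x | x \<in> X \<and> a \<le> f x. a)" by simp
  also have "\<dots> \<le> (\<Sum>x | x \<in> X \<and> a \<le> f x. f x)" by (rule sum_mono) simp
  also have "\<dots> \<le> sum f X" using assms by (intro sum_mono2) auto
  finally show ?thesis .
qed

text \<open>A non-surjective matrix leaves at least half of the fibres empty, so its variance is at
  least \<open>Q ^ t / 2 * c ^ 2\<close>. The total variance allows this for at most a fraction
  \<open>2 / c\<close> of all matrices, and \<open>c \<ge> 4\<close>.\<close>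

lemma card_surj_lin_maps:
  assumes q: "4 * card (UNIV :: 'a::{finite,field} set) ^ t \<le> card (UNIV :: 'a set) ^ n"
  shows "real (card (mats t n :: (nat \<Rightarrow> nat \<Rightarrow> 'a) set))
    \<le> 2 * real (card (surj_lin_maps t n :: (nat \<Rightarrow> nat \<Rightarrow> 'a) set))"
proof -
  let ?q = "card (UNIV :: 'a set)" and ?X = "mats t n :: (nat \<Rightarrow> nat \<Rightarrow> 'a) set"
    and ?V = "vecs n :: (nat \<Rightarrow> 'a) set"
  define Q where "Q = real ?q"
  have Q: "Q > 0" by (simp add: Q_def card_gt_0_iff)
  define c where "c = Q ^ n / Q ^ t"
  have cpos: "c > 0" using Q by (simp add: c_def)
  have cV: "real (card ?V) / real ?q ^ t = c" by (simp add: c_def Q_def card_vecs)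
  define f where "f M = (\<Sum>u\<in>vecs t. (real (card (fiber ?V t n M u)) - c)\<^sup>2)" for M
  define bad where "bad = ?X - surj_lin_maps t n"
  have "Q ^ t / 2 * c\<^sup>2 \<le> f M" if M: "M \<in> bad" for M
  proof -
    let ?I = "apply_mat t n M ` ?V"
    have "?I \<noteq> vecs t" "?I \<subseteq> vecs t" using M by (auto simp: bad_def surj_lin_maps_def)
    then obtain u where u: "u \<in> vecs t" "u \<notin> ?I" by blast
    \<comment> \<open>Translation by a missed point \<open>u\<close> moves the image off itself, so
      the image fills at most half of the target.\<close>
    let ?J = "(\<lambda>v i. u i + v i) ` ?I"
    have "?I \<inter> ?J = {}"
    proof (rule ccontr)
      assume "?I \<inter> ?J \<noteq> {}"
      then obtain x y where xy: "x \<in> ?V" "y \<in> ?V" "apply_mat t n M x = (\<lambda>i. u i + apply_mat t n M y i)"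
        by blast
      then have "u = apply_mat t n M (\<lambda>i. x i - y i)"
        by (simp add: apply_mat_diff fun_eq_iff)
      moreover have "(\<lambda>i. x i - y i) \<in> ?V" using xy by (simp add: vecs_def)
      ultimately show False using u by blast
    qed
    moreover have "?J \<subseteq> vecs t" using u(1) by (auto simp: vecs_def apply_mat_def)
    moreover have "card ?J = card ?I" by (rule card_image) (auto simp: inj_on_def fun_eq_iff)
    ultimately have "card ?I + card ?I \<le> ?q ^ t"
      using card_mono[of "vecs t :: (nat \<Rightarrow> 'a) set" "?I \<union> ?J"] \<open>?I \<subseteq> vecs t\<close>
        card_Un_disjoint[of ?I ?J] by (simp add: card_vecs)
    then have "2 * real (card ?I) \<le> Q ^ t" unfolding Q_def by (simp flip: of_nat_power)
    moreover have "real (card (vecs t - ?I)) = Q ^ t - real (card ?I)"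
      using \<open>?I \<subseteq> vecs t\<close> card_mono[OF _ \<open>?I \<subseteq> vecs t\<close>]
      by (simp add: card_Diff_subset card_vecs Q_def of_nat_diff)
    ultimately have "Q ^ t / 2 * c\<^sup>2 \<le> real (card (vecs t - ?I)) * c\<^sup>2"
      by (intro mult_right_mono) auto
    also have "\<dots> = (\<Sum>u\<in>vecs t - ?I. (real (card (fiber ?V t n M u)) - c)\<^sup>2)"
    proof -
      have "fiber ?V t n M u = {}" if "u \<notin> ?I" for u using that by (auto simp: fiber_def)
      then show ?thesis by simp
    qed
    also have "\<dots> \<le> f M" unfolding f_def by (intro sum_mono2) auto
    finally show ?thesis .
  qed
  then have "(\<Sum>M\<in>bad. Q ^ t / 2 * c\<^sup>2) \<le> (\<Sum>M\<in>bad. f M)" by (rule sum_mono)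
  also have "\<dots> \<le> (\<Sum>M\<in>?X. f M)" unfolding bad_def by (intro sum_mono2) (auto simp: f_def sum_nonneg)
  also have "\<dots> \<le> real (card ?X) * Q ^ n"
    using fiber_variance[of ?V n t] by (simp add: f_def c_def card_vecs Q_def)
  finally have "real (card bad) * (Q ^ t / 2 * c\<^sup>2) \<le> real (card ?X) * Q ^ n" by simp
  moreover have "Q ^ t / 2 * c\<^sup>2 = Q ^ n * (c / 2)" using Q by (simp add: c_def power2_eq_square field_simps)
  ultimately have "Q ^ n * (real (card bad) * (c / 2)) \<le> Q ^ n * real (card ?X)" by (simp add: mult_ac)
  then have *: "real (card bad) * (c / 2) \<le> real (card ?X)"
    using Q by (subst (asm) mult_le_cancel_left_pos) simp_all
  have "4 \<le> c"
  proof -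
    have "real (4 * ?q ^ t) \<le> real (?q ^ n)" using q by (simp only: of_nat_le_iff)
    then show ?thesis using Q by (simp add: c_def Q_def field_simps)
  qed
  then have "real (card bad) * 2 \<le> real (card bad) * (c / 2)" by (intro mult_left_mono) auto
  then have "2 * real (card bad) \<le> real (card ?X)" using * by simp
  moreover have "real (card bad) = real (card ?X) - real (card (surj_lin_maps t n :: (nat \<Rightarrow> nat \<Rightarrow> 'a) set))"
  proof -
    have "surj_lin_maps t n \<subseteq> ?X" by (auto simp: surj_lin_maps_def)
    moreover from this have "finite (surj_lin_maps t n :: (nat \<Rightarrow> nat \<Rightarrow> 'a) set)"
      by (rule finite_subset) simp
    ultimately show ?thesis unfolding bad_def
      by (simp add: card_Diff_subset card_mono of_nat_diff)
  qed
  ultimately show ?thesis by simp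
qed

section \<open>Extension by two rows, greedy covering, changes of coordinates\<close>

definition stack :: "nat \<Rightarrow> (nat \<Rightarrow> nat \<Rightarrow> 'a) \<Rightarrow> (nat \<Rightarrow> nat \<Rightarrow> 'a) \<Rightarrow> nat \<Rightarrow> nat \<Rightarrow> 'a" where
  "stack t L L' = (\<lambda>i. if i < t then L i else L' (i - t))"

lemma bij_betw_stack: "bij_betw (\<lambda>(L, L'). stack t L L') (mats t n \<times> mats k n) (mats (t + k) n :: (nat \<Rightarrow> nat \<Rightarrow> 'a::zero) set)"
proof (rule bij_betw_byWitness[where f' = "\<lambda>M. (\<lambda>i. if i < t then M i else (\<lambda>_. 0), \<lambda>i. M (t + i))"])
  show "\<forall>x\<in>mats t n \<times> mats k n. (case (case x of (L, L') \<Rightarrow> stack t L L') of M \<Rightarrow>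
      (\<lambda>i. if i < t then M i else (\<lambda>_. 0), \<lambda>i. M (t + i))) = x"
    by (auto simp: stack_def fun_eq_iff mats_def)
  show "\<forall>M\<in>mats (t + k) n. (case (\<lambda>i. if i < t then M i else (\<lambda>_. 0), \<lambda>i. M (t + i)) of (L, L') \<Rightarrow> stack t L L') = (M :: nat \<Rightarrow> nat \<Rightarrow> 'a)"
    by (auto simp: stack_def fun_eq_iff mats_def)
  show "(\<lambda>(L, L'). stack t L L') ` (mats t n \<times> mats k n) \<subseteq> (mats (t + k) n :: (nat \<Rightarrow> nat \<Rightarrow> 'a) set)"
    by (auto simp: stack_def mats_def)
  show "(\<lambda>M. (\<lambda>i. if i < t then M i else (\<lambda>_. 0), \<lambda>i. M (t + i))) ` mats (t + k) n
     \<subseteq> mats t n \<times> (mats k n :: (nat \<Rightarrow> nat \<Rightarrow> 'a) set)"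
    by (auto simp: mats_def)
qed

lemma card_mats_add: "card (mats (t + k) n :: (nat \<Rightarrow> nat \<Rightarrow> 'a::zero) set)
    = card (mats t n :: (nat \<Rightarrow> nat \<Rightarrow> 'a) set) * card (mats k n :: (nat \<Rightarrow> nat \<Rightarrow> 'a) set)"
  using bij_betw_same_card[OF bij_betw_stack[of t n k]] by (metis card_cartesian_product)

lemma fiber_stack:
  assumes "y \<in> vecs t"
  shows "fiber S (t + 2) n (stack t L L') (y(t := s1, Suc t := s2))
    = fiber (fiber S t n L y) 2 n L' ((\<lambda>_. 0)(0 := s1, 1 := s2))"
proof -
  have "apply_mat (t + 2) n (stack t L L') x = y(t := s1, Suc t := s2) \<longleftrightarrow>
    apply_mat t n L x = y \<and> apply_mat 2 n L' x = (\<lambda>_. 0)(0 := s1, 1 := s2)" (is "?l = ?r \<longleftrightarrow> _") for x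
  proof
    assume *: "?l = ?r"
    have "apply_mat t n L x i = y i" for i
      using fun_cong[OF *, of i] assms by (cases "i < t") (auto simp: apply_mat_def stack_def vecs_def)
    moreover have "apply_mat 2 n L' x i = ((\<lambda>_. 0)(0 := s1, 1 := s2)) i" for i
      using fun_cong[OF *, of "t + i"] by (cases "i = 0 \<or> i = 1") (auto simp: apply_mat_def stack_def)
    ultimately show "apply_mat t n L x = y \<and> apply_mat 2 n L' x = (\<lambda>_. 0)(0 := s1, 1 := s2)" by auto
  next
    assume *: "apply_mat t n L x = y \<and> apply_mat 2 n L' x = (\<lambda>_. 0)(0 := s1, 1 := s2)"
    have "?l i = ?r i" for i
    proof -
      consider "i < t" | "i = t" | "i = Suc t" | "Suc t < i" by linarith
      then show ?thesis
        using fun_cong[OF conjunct1[OF *], of i] fun_cong[OF conjunct2[OF *], of "i - t"] assms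
        by cases (auto simp: apply_mat_def stack_def vecs_def)
    qed
    then show "?l = ?r" by auto
  qed
  then show ?thesis by (auto simp: fiber_def)
qed

lemma bij_betw_pair_vecs2:
  "bij_betw (\<lambda>(s1, s2). (\<lambda>_. 0)(0 := s1, 1 := s2)) UNIV (vecs 2 :: (nat \<Rightarrow> 'a::zero) set)"
proof (rule bij_betw_byWitness[where f' = "\<lambda>u. (u 0, u 1)"])
  show "\<forall>u\<in>vecs 2. (case (u 0, u 1) of (s1, s2) \<Rightarrow> (\<lambda>_. 0)(0 := s1, 1 := s2)) = (u :: nat \<Rightarrow> 'a)"
    by (auto simp: vecs_def fun_eq_iff)
qed (auto simp: vecs_def)

text \<open>\<open>Y\<close> maximizes the number of covered \<open>b\<close> minus \<open>K\<close>
  times the size of the union. Comparison with the empty family gives the first bound. No further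
  \<open>G\<close> improves \<open>Y\<close>, so \<open>G\<close> covers at most
  \<open>K * card (W G)\<close> new points, and averaging over \<open>G\<close> bounds the uncovered
  ones.\<close>

lemma greedy_cover:
  fixes p K \<rho> :: real
  assumes X: "finite X" "X \<noteq> {}" and U: "finite U" and W: "\<And>G. finite (W G)"
    and cov: "\<And>b. b \<in> U \<Longrightarrow> p * real (card X) \<le> real (card {G \<in> X. C G b})"
    and avg: "(\<Sum>G\<in>X. real (card (W G))) \<le> \<rho> * real (card X)" and "0 \<le> K"
  obtains Y where "Y \<subseteq> X" "K * real (card (\<Union>(W ` Y))) \<le> real (card {b \<in> U. \<exists>G\<in>Y. C G b})"
    "p * real (card {b \<in> U. \<not> (\<exists>G\<in>Y. C G b)}) \<le> K * \<rho>"
proof -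
  define A where "A Y = {b \<in> U. \<exists>G\<in>Y. C G b}" for Y
  define \<Phi> where "\<Phi> Y = real (card (A Y)) - K * real (card (\<Union>(W ` Y)))" for Y
  have fin: "finite (\<Phi> ` Pow X)" using X by simp
  define top where "top = Max (\<Phi> ` Pow X)"
  have "top \<in> \<Phi> ` Pow X" unfolding top_def using fin by (intro Max_in) auto
  then obtain Y where Y: "Y \<subseteq> X" "\<Phi> Y = top" by auto
  have max: "\<Phi> Z \<le> \<Phi> Y" if "Z \<subseteq> X" for Z
    unfolding Y(2) top_def using fin that by (intro Max_ge) auto
  have "finite Y" using Y(1) X(1) finite_subset by blast
  have "\<Phi> {} = 0" by (simp add: \<Phi>_def A_def)
  then have 1: "K * real (card (\<Union>(W ` Y))) \<le> real (card (A Y))" using max[of "{}"] by (simp add: \<Phi>_def)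
  define R where "R = {b \<in> U. \<not> (\<exists>G\<in>Y. C G b)}"
  have new: "real (card {b \<in> R. C G b}) \<le> K * real (card (W G))" if G: "G \<in> X" for G
  proof -
    have "A (insert G Y) = A Y \<union> {b \<in> R. C G b}" by (auto simp: A_def R_def)
    moreover have "card (A Y \<union> {b \<in> R. C G b}) = card (A Y) + card {b \<in> R. C G b}"
      using U by (intro card_Un_disjoint) (auto simp: A_def R_def)
    moreover have "card (\<Union>(W ` insert G Y)) \<le> card (\<Union>(W ` Y)) + card (W G)"
      by (simp add: add.commute card_Un_le)
    then have "K * real (card (\<Union>(W ` insert G Y))) \<le> K * (real (card (\<Union>(W ` Y))) + real (card (W G)))"
      using \<open>0 \<le> K\<close> by (intro mult_left_mono) (simp_all flip: of_nat_add)
    ultimately show ?thesis using max[of "insert G Y"] G Y(1) by (simp add: \<Phi>_def distrib_left)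
  qed
  have "real (card X) * (p * real (card R)) = (\<Sum>b\<in>R. p * real (card X))" by simp
  also have "\<dots> \<le> (\<Sum>b\<in>R. real (card {G \<in> X. C G b}))"
    by (intro sum_mono cov) (auto simp: R_def)
  also have "\<dots> = (\<Sum>b\<in>R. \<Sum>G\<in>X. if C G b then 1 else 0)"
    using X by (simp add: sum.inter_filter[symmetric])
  also have "\<dots> = (\<Sum>G\<in>X. \<Sum>b\<in>R. if C G b then 1 else 0)" by (rule sum.swap)
  also have "\<dots> = (\<Sum>G\<in>X. real (card {b \<in> R. C G b}))"
    using U by (simp add: sum.inter_filter[symmetric] R_def)
  also have "\<dots> \<le> (\<Sum>G\<in>X. K * real (card (W G)))" by (rule sum_mono[OF new])
  also have "\<dots> \<le> K * (\<rho> * real (card X))"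
    using avg \<open>0 \<le> K\<close> by (simp add: sum_distrib_left[symmetric] mult_left_mono)
  finally have "real (card X) * (p * real (card R)) \<le> real (card X) * (K * \<rho>)" by (simp add: mult_ac)
  then have "p * real (card R) \<le> K * \<rho>" using X by (subst (asm) mult_le_cancel_left_pos) (auto simp: card_gt_0_iff)
  with 1 Y(1) show ?thesis using that by (simp add: A_def R_def)
qed

definition mat_mult :: "nat \<Rightarrow> (nat \<Rightarrow> nat \<Rightarrow> 'a::comm_semiring_0) \<Rightarrow> (nat \<Rightarrow> nat \<Rightarrow> 'a) \<Rightarrow> nat \<Rightarrow> nat \<Rightarrow> 'a" where
  "mat_mult m K G = (\<lambda>i j. apply_mat m m K (\<lambda>l. G l j) i)"

lemma apply_mat_mult:
  "apply_mat m n (mat_mult m K G) x = apply_mat m m K (apply_mat m n G x)"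
proof
  fix i
  have "(\<Sum>j<n. (\<Sum>l<m. K i l * G l j) * x j) = (\<Sum>l<m. K i l * (\<Sum>j<n. G l j * x j))"
    unfolding sum_distrib_right sum_distrib_left by (subst sum.swap) (simp add: mult.assoc)
  then show "apply_mat m n (mat_mult m K G) x i = apply_mat m m K (apply_mat m n G x) i"
    by (simp add: apply_mat_def mat_mult_def)
qed

lemma mat_mult_in_mats: "G \<in> mats m n \<Longrightarrow> mat_mult m K G \<in> mats m n"
  by (auto simp: mats_def mat_mult_def apply_mat_def)

lemma inj_on_mat_mult:
  assumes "inj_on (apply_mat m m K) (vecs m)"
  shows "inj_on (mat_mult m K) (mats m n)"
proof (rule inj_onI, intro ext)
  fix G H i j assume *: "G \<in> mats m n" "H \<in> mats m n" "mat_mult m K G = mat_mult m K H"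
  have "apply_mat m m K (\<lambda>l. G l j) = apply_mat m m K (\<lambda>l. H l j)"
    using fun_cong[OF fun_cong[OF *(3)], of _ j] by (simp add: mat_mult_def fun_eq_iff)
  moreover have "(\<lambda>l. G l j) \<in> vecs m" "(\<lambda>l. H l j) \<in> vecs m"
    using * by (auto simp: mats_def vecs_def)
  ultimately have "(\<lambda>l. G l j) = (\<lambda>l. H l j)" using assms by (auto dest: inj_onD)
  then show "G i j = H i j" by (rule fun_cong)
qed

text \<open>Linear independence as a nonzero 2 x 2 minor, whose rows serve as pivots in
  \<open>exists_coordinate_change\<close>.\<close>

definition indep_pairs :: "nat \<Rightarrow> ((nat \<Rightarrow> 'a::field) \<times> (nat \<Rightarrow> 'a)) set" where
  "indep_pairs m = {(b1, b2). b1 \<in> vecs m \<and> b2 \<in> vecs m \<and>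
     (\<exists>i<m. \<exists>j<m. b1 i * b2 j \<noteq> b1 j * b2 i)}"

lemma indep_pairs_subset: "indep_pairs m \<subseteq> vecs m \<times> vecs m"
  by (auto simp: indep_pairs_def)

lemma finite_indep_pairs [simp]: "finite (indep_pairs m :: ((nat \<Rightarrow> 'a::{finite,field}) \<times> (nat \<Rightarrow> 'a)) set)"
  by (rule finite_subset[OF indep_pairs_subset]) simp

text \<open>In a dependent pair either \<open>b1\<close> is zero or \<open>b2\<close> is a multiple
  of \<open>b1\<close>, which leaves at most \<open>q ^ m + q ^ (m + 1)\<close> pairs.\<close>

lemma card_indep_pairs:
  "card (UNIV :: 'a::{finite,field} set) ^ (2 * m) \<le>
    card (indep_pairs m :: ((nat \<Rightarrow> 'a) \<times> (nat \<Rightarrow> 'a)) set) + 2 * card (UNIV :: 'a set) ^ (m + 1)"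
proof -
  let ?V = "vecs m :: (nat \<Rightarrow> 'a) set" and ?q = "card (UNIV :: 'a set)"
  let ?Z = "Pair (\<lambda>_::nat. 0::'a) ` ?V" and ?L = "(\<lambda>(b, c). (b, \<lambda>i. c * b i)) ` (?V \<times> (UNIV :: 'a set))"
  have "?V \<times> ?V \<subseteq> indep_pairs m \<union> (?Z \<union> ?L)"
  proof (rule subsetI, rule ccontr)
    fix p assume p: "p \<in> ?V \<times> ?V" "p \<notin> indep_pairs m \<union> (?Z \<union> ?L)"
    obtain b1 b2 where "p = (b1, b2)" by fastforce
    with p have b: "b1 \<in> ?V" "b2 \<in> ?V" "(b1, b2) \<notin> ?L" "(b1, b2) \<notin> ?Z" "(b1, b2) \<notin> indep_pairs m"
      by auto
    then have "b1 \<noteq> (\<lambda>_. 0)" by blast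
    then obtain i where i: "b1 i \<noteq> 0" by auto
    then have "i < m" using b(1) by (metis (mono_tags) mem_Collect_eq not_le vecs_def)
    have "b1 i * b2 j \<noteq> b1 j * b2 i" if "b2 j \<noteq> b2 i / b1 i * b1 j" for j
      using that i by (auto simp: field_simps)
    moreover have "b2 \<noteq> (\<lambda>j. b2 i / b1 i * b1 j)"
    proof
      assume "b2 = (\<lambda>j. b2 i / b1 i * b1 j)"
      then have "(b1, b2) = (case (b1, b2 i / b1 i) of (b, c) \<Rightarrow> (b, \<lambda>j. c * b j))" by simp
      then show False using b(1,3) by blast
    qed
    then obtain j where j: "b2 j \<noteq> b2 i / b1 i * b1 j" by auto
    moreover have "j < m"
    proof (rule ccontr)
      assume "\<not> j < m"
      then have "b1 j = 0" "b2 j = 0" using b(1,2) by (auto simp: vecs_def)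
      then show False using j by simp
    qed
    ultimately show False using \<open>i < m\<close> b(1,2,5) by (auto simp: indep_pairs_def)
  qed
  then have "card (?V \<times> ?V) \<le> card (indep_pairs m \<union> (?Z \<union> ?L))" by (rule card_mono[rotated]) auto
  also have "\<dots> \<le> card (indep_pairs m :: ((nat \<Rightarrow> 'a) \<times> (nat \<Rightarrow> 'a)) set) + (card ?Z + card ?L)"
    using card_Un_le[of "indep_pairs m :: ((nat \<Rightarrow> 'a) \<times> (nat \<Rightarrow> 'a)) set" "?Z \<union> ?L"] card_Un_le[of ?Z ?L] by linarith
  also have "card ?Z \<le> ?q ^ m" using card_image_le[of ?V "Pair (\<lambda>_. 0)"] by (simp add: card_vecs)
  also have "?q ^ m \<le> ?q ^ (m + 1)" by (simp add: Suc_leI card_gt_0_iff)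
  also have "card ?L \<le> ?q ^ (m + 1)"
    by (rule order_trans[OF card_image_le]) (auto simp: card_cartesian_product card_vecs mult.commute)
  finally show ?thesis by (simp add: card_cartesian_product card_vecs mult_2 power_add)
qed

text \<open>The last two columns of \<open>K\<close> are \<open>b1\<close> and \<open>b2\<close>,
  the others are the unit vectors of the rows outside the pivots \<open>i1\<close> and
  \<open>i2\<close>. On the pivot rows Cramer's rule kills the last two entries of a kernel vector;
  the remaining rows kill the rest.\<close>

lemma exists_coordinate_change:
  fixes b1 b2 :: "nat \<Rightarrow> 'a::field"
  assumes b: "(b1, b2) \<in> indep_pairs (t + 2)"
  obtains K where "inj_on (apply_mat (t + 2) (t + 2) K) (vecs (t + 2))"
    "\<And>y s1 s2. y \<in> vecs t \<Longrightarrow> apply_mat (t + 2) (t + 2) K (y(t := s1, Suc t := s2))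
       = (\<lambda>i. apply_mat (t + 2) (t + 2) K y i + s1 * b1 i + s2 * b2 i)"
proof -
  from b obtain i1 i2 where i: "i1 < t + 2" "i2 < t + 2" and minor: "b1 i1 * b2 i2 \<noteq> b1 i2 * b2 i1"
    and bv: "b1 \<in> vecs (t + 2)" "b2 \<in> vecs (t + 2)"
    by (auto simp: indep_pairs_def)
  then have "i1 \<noteq> i2" by auto
  then have "card {..<t} = card ({..<t + 2} - {i1, i2})" using i by (simp add: card_Diff_subset)
  then obtain \<sigma> where \<sigma>: "bij_betw \<sigma> {..<t} ({..<t + 2} - {i1, i2})"
    using finite_same_card_bij[of "{..<t}" "{..<t + 2} - {i1, i2}"] by auto
  define K where "K i j = (if j < t then (if \<sigma> j = i then 1 else 0) else if j = t then b1 i else b2 i)" for i j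
  let ?K = "apply_mat (t + 2) (t + 2) K"
  have K: "?K u i = (\<Sum>j<t. if \<sigma> j = i then u j else 0) + u t * b1 i + u (Suc t) * b2 i"
    if "i < t + 2" for u i
  proof -
    have "(\<Sum>j<t + 2. K i j * u j) = (\<Sum>j<t. K i j * u j) + K i t * u t + K i (Suc t) * u (Suc t)"
      by simp
    also have "(\<Sum>j<t. K i j * u j) = (\<Sum>j<t. if \<sigma> j = i then u j else 0)"
      by (intro sum.cong) (auto simp: K_def)
    finally show ?thesis using that by (simp add: apply_mat_def K_def mult.commute)
  qed
  have zero: "u = (\<lambda>_. 0)" if u: "u \<in> vecs (t + 2)" and Ku: "?K u = (\<lambda>_. 0)" for u
  proof -
    have "(\<Sum>j<t. if \<sigma> j = i then u j else 0) = 0" if "i = i1 \<or> i = i2" for i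
      using that bij_betwE[OF \<sigma>] by (intro sum.neutral) auto
    then have e: "u t * b1 i1 + u (Suc t) * b2 i1 = 0" "u t * b1 i2 + u (Suc t) * b2 i2 = 0"
      using K[OF i(1), of u] K[OF i(2), of u] Ku by auto
    have "u t * (b1 i1 * b2 i2 - b1 i2 * b2 i1)
      = (u t * b1 i1 + u (Suc t) * b2 i1) * b2 i2 - (u t * b1 i2 + u (Suc t) * b2 i2) * b2 i1"
      by (simp add: algebra_simps)
    then have ut: "u t = 0" using e minor by simp
    have "u (Suc t) * (b1 i1 * b2 i2 - b1 i2 * b2 i1)
      = (u t * b1 i2 + u (Suc t) * b2 i2) * b1 i1 - (u t * b1 i1 + u (Suc t) * b2 i1) * b1 i2"
      by (simp add: algebra_simps)
    then have uSt: "u (Suc t) = 0" using e minor by simp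
    have "u j = 0" if j: "j < t" for j
    proof -
      have "\<sigma> j < t + 2" using bij_betwE[OF \<sigma>] j by auto
      then have "0 = (\<Sum>l<t. if \<sigma> l = \<sigma> j then u l else 0)"
        using K[of "\<sigma> j" u] Ku ut uSt by simp
      also have "\<dots> = (\<Sum>l<t. if l = j then u l else 0)"
        using \<sigma> j by (intro sum.cong) (auto simp: bij_betw_def inj_on_def)
      finally show ?thesis using j by simp
    qed
    moreover have "u j = 0" if "t \<le> j" for j
      using that u ut uSt by (cases "j = t \<or> j = Suc t") (auto simp: vecs_def)
    ultimately show ?thesis by (auto simp: fun_eq_iff not_le[symmetric])
  qed
  have "inj_on ?K (vecs (t + 2))"
  proof (rule inj_onI)
    fix x y assume *: "x \<in> vecs (t + 2)" "y \<in> vecs (t + 2)" "?K x = ?K y"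
    have "(\<lambda>i. x i - y i) = (\<lambda>_. 0)"
    proof (rule zero)
      show "(\<lambda>i. x i - y i) \<in> vecs (t + 2)" using *(1,2) by (simp add: vecs_def)
      show "?K (\<lambda>i. x i - y i) = (\<lambda>_. 0)" unfolding apply_mat_diff *(3) by simp
    qed
    then show "x = y" by (simp add: fun_eq_iff)
  qed
  moreover have "?K (y(t := s1, Suc t := s2)) = (\<lambda>i. ?K y i + s1 * b1 i + s2 * b2 i)" if y: "y \<in> vecs t" for y s1 s2
  proof
    fix i
    show "?K (y(t := s1, Suc t := s2)) i = ?K y i + s1 * b1 i + s2 * b2 i"
    proof (cases "i < t + 2")
      case True
      have "(\<Sum>j<t. if \<sigma> j = i then (y(t := s1, Suc t := s2)) j else 0) = (\<Sum>j<t. if \<sigma> j = i then y j else 0)"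
        by (intro sum.cong) auto
      then show ?thesis using y unfolding K[OF True] by (simp add: vecs_def)
    next
      case False
      then show ?thesis using bv by (simp add: apply_mat_def vecs_def)
    qed
  qed
  ultimately show ?thesis using that by blast
qed

definition deviant :: "(nat \<Rightarrow> 'a::comm_semiring_0) set \<Rightarrow> nat \<Rightarrow> nat \<Rightarrow> real \<Rightarrow> real \<Rightarrow> (nat \<Rightarrow> nat \<Rightarrow> 'a) \<Rightarrow> (nat \<Rightarrow> 'a) set" where
  "deviant S m n \<mu> c G = {u \<in> vecs m. c \<le> \<bar>real (card (fiber S m n G u)) - \<mu>\<bar>}"

lemma deviant_mat_mult:
  assumes "inj_on (apply_mat m m K) (vecs m)" "u \<in> deviant S m n \<mu> c G"
  shows "apply_mat m m K u \<in> deviant S m n \<mu> c (mat_mult m K G)"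
proof -
  have "u \<in> vecs m" using assms(2) by (simp add: deviant_def)
  then have "fiber S m n (mat_mult m K G) (apply_mat m m K u) = fiber S m n G u"
    using assms(1) by (auto simp: fiber_def apply_mat_mult dest: inj_onD)
  then show ?thesis using assms(2) by (simp add: deviant_def)
qed

text \<open>Counts parameter pairs of a translated plane, the quantity in
  \<open>kakeya_planes\<close>; \<open>coordinate_rich\<close> is the version for the last two
  coordinate directions.\<close>

definition rich :: "(nat \<Rightarrow> 'a::comm_semiring_0) set \<Rightarrow> (nat \<Rightarrow> 'a) \<Rightarrow> (nat \<Rightarrow> 'a) \<Rightarrow> real \<Rightarrow> bool" where
  "rich E b1 b2 N \<longleftrightarrow> (\<exists>a. N \<le> real (card {(s1, s2). (\<lambda>i. a i + s1 * b1 i + s2 * b2 i) \<in> E}))"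

definition coordinate_rich :: "(nat \<Rightarrow> 'a::comm_semiring_0) set \<Rightarrow> nat \<Rightarrow> real \<Rightarrow> bool" where
  "coordinate_rich E t N \<longleftrightarrow> (\<exists>y\<in>vecs t. N \<le> real (card {(s1, s2). y(t := s1, Suc t := s2) \<in> E}))"

text \<open>Left multiplication by \<open>K\<close> is injective on matrices and carries deviant
  sets along, moving the last two coordinate directions to \<open>b1\<close> and \<open>b2\<close>.
  So every independent pair is rich at least as often as the coordinate pair.\<close>

lemma card_rich_ge:
  fixes S :: "(nat \<Rightarrow> 'a::{finite,field}) set"
  assumes b: "(b1, b2) \<in> indep_pairs (t + 2)"
  shows "card {G \<in> mats (t + 2) n. coordinate_rich (deviant S (t + 2) n \<mu> c G) t N}
    \<le> card {G \<in> mats (t + 2) n. rich (deviant S (t + 2) n \<mu> c G) b1 b2 N}"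
proof -
  obtain K where K: "inj_on (apply_mat (t + 2) (t + 2) K) (vecs (t + 2))"
    and Kb: "\<And>y s1 s2. y \<in> vecs t \<Longrightarrow> apply_mat (t + 2) (t + 2) K (y(t := s1, Suc t := s2))
       = (\<lambda>i. apply_mat (t + 2) (t + 2) K y i + s1 * b1 i + s2 * b2 i)"
    by (rule exists_coordinate_change[OF b], rule that)
  show ?thesis
  proof (rule card_inj_on_le)
    show "inj_on (mat_mult (t + 2) K) {G \<in> mats (t + 2) n. coordinate_rich (deviant S (t + 2) n \<mu> c G) t N}"
      by (rule inj_on_subset[OF inj_on_mat_mult[OF K]]) auto
    show "mat_mult (t + 2) K ` {G \<in> mats (t + 2) n. coordinate_rich (deviant S (t + 2) n \<mu> c G) t N}
      \<subseteq> {G \<in> mats (t + 2) n. rich (deviant S (t + 2) n \<mu> c G) b1 b2 N}"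
    proof clarify
      fix G :: "nat \<Rightarrow> nat \<Rightarrow> 'a" assume G: "G \<in> mats (t + 2) n"
        and "coordinate_rich (deviant S (t + 2) n \<mu> c G) t N"
      then obtain y where y: "y \<in> vecs t"
        and N: "N \<le> real (card {(s1, s2). y(t := s1, Suc t := s2) \<in> deviant S (t + 2) n \<mu> c G})"
        by (auto simp: coordinate_rich_def)
      let ?a = "apply_mat (t + 2) (t + 2) K y"
      have "{(s1, s2). y(t := s1, Suc t := s2) \<in> deviant S (t + 2) n \<mu> c G}
        \<subseteq> {(s1, s2). (\<lambda>i. ?a i + s1 * b1 i + s2 * b2 i) \<in> deviant S (t + 2) n \<mu> c (mat_mult (t + 2) K G)}"
        using deviant_mat_mult[OF K, of "y(t := s1, Suc t := s2)" for s1 s2, unfolded Kb[OF y]] by blast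
      then have "card {(s1, s2). y(t := s1, Suc t := s2) \<in> deviant S (t + 2) n \<mu> c G}
        \<le> card {(s1, s2). (\<lambda>i. ?a i + s1 * b1 i + s2 * b2 i) \<in> deviant S (t + 2) n \<mu> c (mat_mult (t + 2) K G)}"
        by (rule card_mono[rotated]) simp
      then have "rich (deviant S (t + 2) n \<mu> c (mat_mult (t + 2) K G)) b1 b2 N"
        unfolding rich_def using N by (intro exI[of _ ?a]) linarith
      then show "mat_mult (t + 2) K G \<in> mats (t + 2) n \<and> rich (deviant S (t + 2) n \<mu> c (mat_mult (t + 2) K G)) b1 b2 N"
        using mat_mult_in_mats[OF G] by blast
    qed
  qed simp
qed

section \<open>Deviant fibres\<close>

text \<open>The fibre of \<open>L\<close> over \<open>y\<close> splits under \<open>L'\<close> into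
  \<open>Q ^ 2\<close> parts of mean size \<open>\<nu>\<close>, far from \<open>\<mu>\<close>. If
  \<open>L'\<close> is not good, at least \<open>\<eta> * Q ^ 2\<close> parts are close to
  \<open>\<mu>\<close>, hence far from \<open>\<nu>\<close>; by the second moment and Markov this
  happens for at most half of all \<open>L'\<close>.\<close>

lemma rich_extension:
  fixes S :: "(nat \<Rightarrow> 'a::{finite,field}) set" and \<tau> \<mu> \<eta> :: real
  defines "Q \<equiv> real (card (UNIV :: 'a set))"
  assumes S: "S \<subseteq> vecs n" and y: "y \<in> vecs t" and pos: "0 < \<tau>" "0 < \<mu>"
    and dev: "\<tau> * \<mu> < \<bar>real (card (fiber S t n L y)) / Q\<^sup>2 - \<mu>\<bar>"
    and \<eta>: "8 * (1 + \<tau>) \<le> \<eta> * (\<tau>\<^sup>2 * \<mu>)"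
  shows "real (card (mats 2 n :: (nat \<Rightarrow> nat \<Rightarrow> 'a) set)) \<le> 2 * real (card {L' \<in> mats 2 n.
    coordinate_rich (deviant S (t + 2) n \<mu> (\<tau> * \<mu> / 2) (stack t L L')) t ((1 - \<eta>) * Q\<^sup>2)})"
proof -
  let ?X = "mats 2 n :: (nat \<Rightarrow> nat \<Rightarrow> 'a) set"
  let ?good = "\<lambda>L'. coordinate_rich (deviant S (t + 2) n \<mu> (\<tau> * \<mu> / 2) (stack t L L')) t ((1 - \<eta>) * Q\<^sup>2)"
  have Q: "Q > 0" by (simp add: Q_def card_gt_0_iff)
  define T where "T = fiber S t n L y"
  define \<nu> where "\<nu> = real (card T) / Q\<^sup>2"
  define x where "x = \<bar>\<nu> - \<mu>\<bar>"
  have x: "\<tau> * \<mu> < x" using dev by (simp add: x_def \<nu>_def T_def)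
  then have "0 < x" using pos by (meson mult_pos_pos less_trans)
  have \<eta>pos: "0 < \<eta>"
  proof (rule ccontr)
    assume "\<not> 0 < \<eta>"
    then have "\<eta> * (\<tau>\<^sup>2 * \<mu>) \<le> 0" using pos by (intro mult_nonpos_nonneg) auto
    with \<eta> pos show False by simp
  qed
  \<comment> \<open>Makes the Markov bound at most 1/2 for fibres of any size: \<open>\<nu>\<close>
    is at most \<open>\<mu> + x\<close>, which is small against \<open>x ^ 2\<close> because
    \<open>x\<close> exceeds \<open>\<tau> * \<mu>\<close>.\<close>
  have \<nu>: "8 * \<nu> \<le> \<eta> * x\<^sup>2"
  proof -
    have "\<tau>\<^sup>2 * \<mu> * (\<mu> + x) \<le> (1 + \<tau>) * x\<^sup>2"
    proof -
      have "(\<tau> * \<mu>) * (\<tau> * \<mu>) \<le> x * x" using x pos \<open>0 < x\<close> by (intro mult_mono) auto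
      moreover have "\<tau> * (\<tau> * \<mu> * x) \<le> \<tau> * (x * x)" using x pos \<open>0 < x\<close> by (intro mult_left_mono mult_right_mono) auto
      ultimately show ?thesis by (simp add: algebra_simps power2_eq_square)
    qed
    then have "8 * (\<tau>\<^sup>2 * \<mu> * (\<mu> + x)) \<le> 8 * ((1 + \<tau>) * x\<^sup>2)" by (rule mult_left_mono) simp
    also have "\<dots> = (8 * (1 + \<tau>)) * x\<^sup>2" by (simp only: mult.assoc)
    also have "\<dots> \<le> \<eta> * (\<tau>\<^sup>2 * \<mu>) * x\<^sup>2" by (intro mult_right_mono \<eta>) auto
    finally have "(\<tau>\<^sup>2 * \<mu>) * (8 * (\<mu> + x)) \<le> (\<tau>\<^sup>2 * \<mu>) * (\<eta> * x\<^sup>2)"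
      by (simp only: mult_ac)
    then have "8 * (\<mu> + x) \<le> \<eta> * x\<^sup>2" using pos by (subst (asm) mult_le_cancel_left_pos) auto
    moreover have "\<nu> \<le> \<mu> + x" by (simp add: x_def)
    ultimately show ?thesis by simp
  qed
  define f where "f L' = (\<Sum>u\<in>vecs 2. (real (card (fiber T 2 n L' u)) - \<nu>)\<^sup>2)" for L'
  have low: "\<eta> * Q\<^sup>2 * (x\<^sup>2 / 4) \<le> f L'" if "\<not> ?good L'" for L'
  proof -
    define in2 where "in2 = (\<lambda>(s1, s2). (\<lambda>_. 0)(0 := s1, 1 := s2 :: 'a) :: nat \<Rightarrow> 'a)"
    let ?D = "{(s1, s2). y(t := s1, Suc t := s2) \<in> deviant S (t + 2) n \<mu> (\<tau> * \<mu> / 2) (stack t L L')}"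
    have "real (card ?D) < (1 - \<eta>) * Q\<^sup>2"
      using that y by (auto simp: coordinate_rich_def not_le)
    moreover have "real (card (- ?D)) = Q\<^sup>2 - real (card ?D)"
    proof -
      have "card (- ?D) + card ?D = card (UNIV :: ('a \<times> 'a) set)"
        by (subst card_Un_disjoint[symmetric]) auto
      also have "\<dots> = card (UNIV :: 'a set) * card (UNIV :: 'a set)"
        by (metis UNIV_Times_UNIV card_cartesian_product)
      finally show ?thesis by (simp add: Q_def power2_eq_square flip: of_nat_mult of_nat_add)
    qed
    ultimately have "\<eta> * Q\<^sup>2 \<le> real (card (- ?D))" by (simp add: algebra_simps)
    then have "\<eta> * Q\<^sup>2 * (x\<^sup>2 / 4) \<le> real (card (- ?D)) * (x\<^sup>2 / 4)" by (intro mult_right_mono) auto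
    also have "\<dots> = (\<Sum>s\<in>- ?D. x\<^sup>2 / 4)" by simp
    also have "\<dots> \<le> (\<Sum>s\<in>- ?D. (real (card (fiber T 2 n L' (in2 s))) - \<nu>)\<^sup>2)"
    proof (rule sum_mono)
      fix s assume "s \<in> - ?D"
      then obtain s1 s2 where s: "s = (s1, s2)"
        "y(t := s1, Suc t := s2) \<notin> deviant S (t + 2) n \<mu> (\<tau> * \<mu> / 2) (stack t L L')" by auto
      have "y(t := s1, Suc t := s2) \<in> vecs (t + 2)" using y by (auto simp: vecs_def)
      then have "\<bar>real (card (fiber T 2 n L' (in2 s))) - \<mu>\<bar> < \<tau> * \<mu> / 2"
        using s fiber_stack[OF y, of S n L L' s1 s2] by (simp add: deviant_def in2_def T_def)
      moreover have "\<bar>\<nu> - \<mu>\<bar> \<le> \<bar>real (card (fiber T 2 n L' (in2 s))) - \<nu>\<bar> + \<bar>real (card (fiber T 2 n L' (in2 s))) - \<mu>\<bar>"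
        by arith
      \<comment> \<open>The distance to \<open>\<nu>\<close> is at least
        \<open>x - \<tau> * \<mu> / 2\<close>, and \<open>\<tau> * \<mu> < x\<close>.\<close>
      ultimately have "x / 2 \<le> \<bar>real (card (fiber T 2 n L' (in2 s))) - \<nu>\<bar>"
        using x unfolding x_def by simp
      then have "(x / 2)\<^sup>2 \<le> \<bar>real (card (fiber T 2 n L' (in2 s))) - \<nu>\<bar>\<^sup>2"
        using \<open>0 < x\<close> by (intro power_mono) auto
      then show "x\<^sup>2 / 4 \<le> (real (card (fiber T 2 n L' (in2 s))) - \<nu>)\<^sup>2" by (simp add: power_divide)
    qed
    also have "\<dots> \<le> (\<Sum>s\<in>UNIV. (real (card (fiber T 2 n L' (in2 s))) - \<nu>)\<^sup>2)"
      by (intro sum_mono2) auto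
    also have "\<dots> = f L'"
      unfolding f_def in2_def by (rule sum.reindex_bij_betw[OF bij_betw_pair_vecs2])
    finally show ?thesis .
  qed
  have fin: "finite ?X" by simp
  have "\<eta> * Q\<^sup>2 * (x\<^sup>2 / 4) * real (card {L' \<in> ?X. \<not> ?good L'})
    \<le> \<eta> * Q\<^sup>2 * (x\<^sup>2 / 4) * real (card {L' \<in> ?X. \<eta> * Q\<^sup>2 * (x\<^sup>2 / 4) \<le> f L'})"
    using low \<eta>pos by (intro mult_left_mono of_nat_mono card_mono) auto
  also have "\<dots> \<le> sum f ?X" by (rule markov_card[OF fin]) (simp add: f_def sum_nonneg)
  also have "\<dots> \<le> real (card ?X) * real (card T)"
  proof -
    have "T \<subseteq> vecs n" using S by (auto simp: T_def fiber_def)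
    from fiber_variance[OF this, of 2] show ?thesis by (simp add: f_def \<nu>_def Q_def)
  qed
  also have "\<dots> = Q\<^sup>2 / 8 * (real (card ?X) * (8 * \<nu>))" using Q by (simp add: \<nu>_def)
  also have "\<dots> \<le> Q\<^sup>2 / 8 * (real (card ?X) * (\<eta> * x\<^sup>2))" using \<nu> by (intro mult_left_mono) auto
  finally have "(\<eta> * Q\<^sup>2 * x\<^sup>2 / 8) * (2 * real (card {L' \<in> ?X. \<not> ?good L'}))
    \<le> (\<eta> * Q\<^sup>2 * x\<^sup>2 / 8) * real (card ?X)" by (simp add: mult_ac)
  then have half: "2 * real (card {L' \<in> ?X. \<not> ?good L'}) \<le> real (card ?X)"
    using \<eta>pos Q \<open>0 < x\<close> by (subst (asm) mult_le_cancel_left_pos) auto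
  have "?X = {L' \<in> ?X. \<not> ?good L'} \<union> {L' \<in> ?X. ?good L'}" by auto
  then have "card ?X \<le> card {L' \<in> ?X. \<not> ?good L'} + card {L' \<in> ?X. ?good L'}"
    by (rule ord_eq_le_trans[OF arg_cong[of _ _ card] card_Un_le])
  then have "real (card ?X) \<le> real (card {L' \<in> ?X. \<not> ?good L'}) + real (card {L' \<in> ?X. ?good L'})"
    by (simp flip: of_nat_add)
  then show ?thesis using half by linarith
qed

lemma sum_card_deviant:
  fixes S :: "(nat \<Rightarrow> 'a::{finite,field}) set"
  assumes "S \<subseteq> vecs n" "0 < c" "\<mu> = real (card S) / real (card (UNIV :: 'a set)) ^ m"
  shows "(\<Sum>G\<in>mats m n. real (card (deviant S m n \<mu> c G)))
    \<le> real (card S) / c\<^sup>2 * real (card (mats m n :: (nat \<Rightarrow> nat \<Rightarrow> 'a) set))"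
proof -
  let ?X = "mats m n :: (nat \<Rightarrow> nat \<Rightarrow> 'a) set"
  have "c\<^sup>2 * real (card (deviant S m n \<mu> c G)) \<le> (\<Sum>u\<in>vecs m. (real (card (fiber S m n G u)) - \<mu>)\<^sup>2)" for G
  proof -
    have "deviant S m n \<mu> c G = {u \<in> vecs m. c\<^sup>2 \<le> (real (card (fiber S m n G u)) - \<mu>)\<^sup>2}"
      using \<open>0 < c\<close> abs_le_square_iff[of c] unfolding deviant_def by auto
    then show ?thesis
      using markov_card[of "vecs m" "\<lambda>u. (real (card (fiber S m n G u)) - \<mu>)\<^sup>2" "c\<^sup>2"] by simp
  qed
  then have "(\<Sum>G\<in>?X. c\<^sup>2 * real (card (deviant S m n \<mu> c G)))
    \<le> (\<Sum>G\<in>?X. \<Sum>u\<in>vecs m. (real (card (fiber S m n G u)) - \<mu>)\<^sup>2)" by (rule sum_mono)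
  also have "\<dots> \<le> real (card ?X) * real (card S)" using fiber_variance[OF assms(1)] assms(3) by simp
  finally show ?thesis using \<open>0 < c\<close> by (simp add: sum_distrib_left[symmetric] field_simps)
qed

section \<open>The Kakeya bound with explicit parameters\<close>

lemma binomial_ratio:
  "m' \<le> m \<Longrightarrow> d ^ m' * ((N + m') choose m') \<le> (N + 1 + m) ^ m' * ((d + m') choose m')"
proof (induction m')
  case (Suc k)
  have step: "Suc k * ((a + Suc k) choose Suc k) = (a + Suc k) * ((a + k) choose k)" for a
    using Suc_times_binomial_eq[of "a + k" k] by (simp add: mult.commute)
  have "Suc k * (d ^ Suc k * ((N + Suc k) choose Suc k)) = d ^ Suc k * (Suc k * ((N + Suc k) choose Suc k))"
    by (simp only: mult.left_commute)
  also have "\<dots> = (d * (N + Suc k)) * (d ^ k * ((N + k) choose k))"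
    unfolding step by (simp only: mult_ac power_Suc)
  also have "\<dots> \<le> ((N + 1 + m) * (d + Suc k)) * ((N + 1 + m) ^ k * ((d + k) choose k))"
  proof (rule mult_mono)
    \<comment> \<open>The binomials are compared factor by factor with
      \<open>d / (N + 1 + m)\<close>; as \<open>Suc k \<le> m\<close>, one denominator serves for
      all factors.\<close>
    have "d * (N + Suc k) \<le> (d + Suc k) * (N + 1 + m)" using Suc.prems by (intro mult_mono) auto
    then show "d * (N + Suc k) \<le> (N + 1 + m) * (d + Suc k)" by (simp add: mult.commute)
    show "d ^ k * ((N + k) choose k) \<le> (N + 1 + m) ^ k * ((d + k) choose k)"
      using Suc.prems by (intro Suc.IH) simp
  qed simp_all
  also have "\<dots> = (N + 1 + m) ^ Suc k * (Suc k * ((d + Suc k) choose Suc k))"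
    unfolding step by (simp only: mult_ac power_Suc)
  also have "\<dots> = Suc k * ((N + 1 + m) ^ Suc k * ((d + Suc k) choose Suc k))"
    by (simp only: mult.left_commute)
  finally show ?case by (simp only: mult_le_cancel1 zero_less_Suc)
qed simp

text \<open>\<open>kakeya_planes\<close> with the binomials replaced by powers bounds
  \<open>card E\<close> below by \<open>(d / (N + 1 + m)) ^ m\<close>, more than half of
  \<open>q ^ m\<close> because \<open>32 * n \<le> q\<close>.\<close>

lemma kakeya_density:
  fixes E :: "(nat \<Rightarrow> 'a::{finite,field}) set"
  defines "q \<equiv> card (UNIV :: 'a set)"
  assumes E: "finite E" and D: "D \<subseteq> vecs m \<times> vecs m" and n: "m \<le> n" "1 \<le> n" "32 * n \<le> q"
    and planes: "\<And>b1 b2. (b1, b2) \<in> D \<Longrightarrow> rich E b1 b2 ((1 - 1 / (4 * real n)) * (real q)\<^sup>2)"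
    and many: "real q ^ (2 * m) \<le> 2 * real (card D)"
  shows "real q ^ m < 2 * real (card E)"
proof -
  \<comment> \<open>Order \<open>2 * L\<close> on the planes pays for \<open>D\<close> holding only
    half of all pairs; the \<open>- 1\<close> in \<open>d\<close> makes \<open>many\<close> strict.
    As \<open>L = 4 * n ^ 2 * (1 - 1 / (4 * n))\<close>, multiplicity \<open>4 * n ^ 2 * q\<close>
    suffices on a rich plane, and the further \<open>2 * L\<close> covers the derivatives.\<close>
  define L where "L = (4 * n - 1) * n"
  define d where "d = L * q\<^sup>2 - 1"
  define N where "N = 4 * n * n * q + 2 * L - 1"
  have q: "1 \<le> q" using n by simp
  have L: "1 \<le> L" using n by (simp add: L_def Suc_le_eq)
  have Lr: "real L = (4 * real n - 1) * real n" using n by (simp add: L_def of_nat_diff)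
  have Lq: "1 \<le> L * q\<^sup>2" using L q by (simp add: Suc_le_eq)
  have N1: "N + 1 = 4 * n * n * q + 2 * L" using n q by (simp add: N_def Suc_le_eq)
  have "(d + m) choose m \<le> card E * ((N + 1 - 1 + m) choose m)"
  proof (rule kakeya_planes[where l = "2 * L" and D = D])
    show "finite E" by (rule E)
    show "D \<subseteq> grid m (\<lambda>_. UNIV) \<times> grid m (\<lambda>_. UNIV)" using D by (simp add: vecs_eq_grid)
    show "d * card (UNIV :: 'a set) ^ (2 * m) < (card (UNIV :: 'a set))\<^sup>2 * (2 * L * card D)"
    proof -
      have "real (q ^ (2 * m)) \<le> real (2 * card D)" using many by simp
      then have "q ^ (2 * m) \<le> 2 * card D" by (simp only: of_nat_le_iff)
      then have *: "L * q\<^sup>2 * q ^ (2 * m) \<le> L * q\<^sup>2 * (2 * card D)" by (rule mult_le_mono2)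
      have "d * q ^ (2 * m) < L * q\<^sup>2 * q ^ (2 * m)" using Lq q by (simp add: d_def)
      also note *
      also have "L * q\<^sup>2 * (2 * card D) = q\<^sup>2 * (2 * L * card D)" by (simp only: mult_ac)
      finally show ?thesis unfolding q_def[symmetric] .
    qed
    fix b1 b2 g assume b: "(b1, b2) \<in> D" and g: "g < 2 * L"
    from planes[OF b] obtain a where
      a: "(1 - 1 / (4 * real n)) * (real q)\<^sup>2 \<le> real (card {(s1, s2). (\<lambda>i. a i + s1 * b1 i + s2 * b2 i) \<in> E})"
      by (auto simp: rich_def)
    have "(d - g) * q < (N + 1 - g) * card {(s1, s2). (\<lambda>i. a i + s1 * b1 i + s2 * b2 i) \<in> E}"
    proof -
      have n0: "real n > 0" using n by simp
      have "real ((d - g) * q) \<le> real (d * q)" by (intro of_nat_mono mult_le_mono1) simp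
      also have "\<dots> = real d * real q" by simp
      also have "\<dots> < real (L * q\<^sup>2) * real q" using Lq q by (simp add: d_def of_nat_diff del: of_nat_mult)
      also have "real (L * q\<^sup>2) * real q = real (4 * n * n * q) * ((1 - 1 / (4 * real n)) * (real q)\<^sup>2)"
        using n0 by (simp add: Lr field_simps power2_eq_square)
      also have "\<dots> \<le> real (N + 1 - g) * ((1 - 1 / (4 * real n)) * (real q)\<^sup>2)"
        using g N1 n0 n by (intro mult_right_mono of_nat_mono mult_nonneg_nonneg) (auto simp: field_simps)
      also have "\<dots> \<le> real (N + 1 - g) * real (card {(s1, s2). (\<lambda>i. a i + s1 * b1 i + s2 * b2 i) \<in> E})"
        by (intro mult_left_mono a) auto
      finally show ?thesis by (simp flip: of_nat_mult)
    qed
    then show "\<exists>a. (d - g) * card (UNIV :: 'a set)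
      < (N + 1 - g) * card {(s1, s2). (\<lambda>i. a i + s1 * b1 i + s2 * b2 i) \<in> E}"
      unfolding q_def by blast
  qed
  then have up: "real ((d + m) choose m) \<le> real (card E) * real ((N + m) choose m)"
    by (simp flip: of_nat_mult)
  have Npos: "0 < (N + m) choose m" by simp
  have "real (d ^ m * ((N + m) choose m)) \<le> real ((N + 1 + m) ^ m * ((d + m) choose m))"
    using binomial_ratio[of m m d N] by (simp only: of_nat_le_iff)
  also have "\<dots> \<le> real ((N + 1 + m) ^ m) * (real (card E) * real ((N + m) choose m))"
    unfolding of_nat_mult by (intro mult_left_mono up) simp
  finally have "real ((N + m) choose m) * (real d ^ m) \<le> real ((N + m) choose m) * (real (N + 1 + m) ^ m * real (card E))"
    by (simp add: mult_ac)
  then have dE: "real d ^ m \<le> real (N + 1 + m) ^ m * real (card E)"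
    using Npos by (subst (asm) mult_le_cancel_left_pos) simp_all
  \<comment> \<open>A loss of \<open>1 / (4 * n)\<close> comes from \<open>L\<close> and one of at
    most \<open>2 / q \<le> 1 / (16 * n)\<close> from the denominator. The slack up to
    \<open>2 / (5 * n)\<close> absorbs the \<open>- 1\<close> in \<open>d\<close>, and
    \<open>m * x \<le> 2 / 5\<close> keeps the power above 1/2.\<close>
  define x where "x = 2 / (5 * real n)"
  have x: "0 \<le> x" "x \<le> 1" using n by (auto simp: x_def field_simps)
  have "real (N + 1 + m) * (real q * (1 - x)) \<le> real d"
  proof -
    define Q R where "Q = real q" and "R = real n"
    have QR: "32 * R \<le> Q" "1 \<le> R" using n unfolding Q_def R_def by (simp_all flip: of_nat_mult)
    have "m + 2 * L \<le> 8 * n * n" using n by (simp add: L_def algebra_simps)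
    then have "real (N + 1 + m) \<le> real (4 * n * n * q + 8 * n * n)" unfolding N1 by (intro of_nat_mono) simp
    then have "real (N + 1 + m) * (Q * (1 - x)) \<le> (4 * R * R * Q + 8 * R * R) * (Q * (1 - x))"
      using x QR by (intro mult_right_mono) (auto simp: Q_def R_def)
    also have "\<dots> = 4 * R * R * Q * Q + 8 * R * R * Q - 8 / 5 * R * Q * Q - 16 / 5 * R * Q"
      using QR unfolding x_def R_def[symmetric] by (simp add: field_simps)
    also have "\<dots> \<le> (4 * R - 1) * R * Q\<^sup>2 - 1"
    proof -
      have "(R * Q) * (32 * R) \<le> (R * Q) * Q" using QR by (intro mult_left_mono) auto
      moreover have "1 * 1 \<le> R * Q" using QR by (intro mult_mono) auto
      moreover have "0 \<le> R * Q * R" using QR by simp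
      ultimately show ?thesis by (simp add: algebra_simps power2_eq_square)
    qed
    also have "\<dots> = real d" using Lq by (simp add: d_def of_nat_diff Lr Q_def R_def)
    finally show ?thesis by (simp add: Q_def)
  qed
  then have "(real (N + 1 + m) * (real q * (1 - x))) ^ m \<le> real d ^ m"
    using x by (intro power_mono) auto
  then have "real (N + 1 + m) ^ m * (real q ^ m * (1 - x) ^ m) \<le> real (N + 1 + m) ^ m * real (card E)"
    using dE by (simp only: power_mult_distrib)
  then have "real q ^ m * (1 - x) ^ m \<le> real (card E)"
    by (subst (asm) mult_le_cancel_left_pos) simp_all
  moreover have "real q ^ m * (1 / 2) < real q ^ m * (1 - x) ^ m"
  proof (rule mult_strict_left_mono)
    have "real m * x \<le> 2 / 5" using n by (simp add: x_def field_simps)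
    moreover have "1 + real m * (- x) \<le> (1 + (- x)) ^ m" using x by (intro Bernoulli_inequality) simp
    ultimately show "1 / 2 < (1 - x) ^ m" by simp
    show "0 < real q ^ m" using q by simp
  qed
  ultimately show ?thesis by simp
qed

text \<open>At least half of the two-row extensions of every bad map are good, and distinct pairs
  stack to distinct matrices.\<close>

lemma card_coordinate_rich:
  fixes S :: "(nat \<Rightarrow> 'a::{finite,field}) set" and \<tau> \<mu> \<eta> :: real
  assumes S: "S \<subseteq> vecs n" and pos: "0 < \<tau>" "0 < \<mu>" and \<eta>: "8 * (1 + \<tau>) \<le> \<eta> * (\<tau>\<^sup>2 * \<mu>)"
    and B: "B \<subseteq> mats t n"
    and bad: "\<And>L. L \<in> B \<Longrightarrow> \<exists>y\<in>vecs t.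
      \<tau> * \<mu> < \<bar>real (card (fiber S t n L y)) / (real (card (UNIV :: 'a set)))\<^sup>2 - \<mu>\<bar>"
  shows "real (card B) * real (card (mats 2 n :: (nat \<Rightarrow> nat \<Rightarrow> 'a) set)) \<le> 2 * real (card {G \<in> mats (t + 2) n.
    coordinate_rich (deviant S (t + 2) n \<mu> (\<tau> * \<mu> / 2) G) t ((1 - \<eta>) * (real (card (UNIV :: 'a set)))\<^sup>2)})"
proof -
  let ?X = "mats 2 n :: (nat \<Rightarrow> nat \<Rightarrow> 'a) set"
  define good where "good G \<longleftrightarrow> coordinate_rich (deviant S (t + 2) n \<mu> (\<tau> * \<mu> / 2) G) t
    ((1 - \<eta>) * (real (card (UNIV :: 'a set)))\<^sup>2)" for G
  let ?P = "SIGMA L:B. {L' \<in> ?X. good (stack t L L')}"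
  have fin: "finite B" by (rule finite_subset[OF B]) simp
  have "real (card B) * real (card ?X) = (\<Sum>L\<in>B. real (card ?X))" by simp
  also have "\<dots> \<le> (\<Sum>L\<in>B. 2 * real (card {L' \<in> ?X. good (stack t L L')}))"
  proof (rule sum_mono)
    fix L assume "L \<in> B"
    from bad[OF this] obtain y where "y \<in> vecs t"
      "\<tau> * \<mu> < \<bar>real (card (fiber S t n L y)) / (real (card (UNIV :: 'a set)))\<^sup>2 - \<mu>\<bar>" by auto
    from rich_extension[OF S this(1) pos this(2) \<eta>]
    show "real (card ?X) \<le> 2 * real (card {L' \<in> ?X. good (stack t L L')})" by (simp add: good_def)
  qed
  also have "\<dots> = 2 * real (card ?P)"
    using fin by (simp add: sum_distrib_left card_SigmaI)
  also have "card ?P \<le> card {G \<in> mats (t + 2) n. good G}"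
  proof (rule card_inj_on_le)
    have bij: "bij_betw (\<lambda>(L, L'). stack t L L') (mats t n \<times> ?X) (mats (t + 2) n)" by (rule bij_betw_stack)
    have sub: "?P \<subseteq> mats t n \<times> ?X" using B by auto
    show "inj_on (\<lambda>(L, L'). stack t L L') ?P"
      by (rule inj_on_subset[OF bij_betw_imp_inj_on[OF bij] sub])
    show "(\<lambda>(L, L'). stack t L L') ` ?P \<subseteq> {G \<in> mats (t + 2) n. good G}"
      using bij_betwE[OF bij] B by auto
  qed simp
  finally show ?thesis unfolding good_def by simp
qed

section \<open>Too many bad maps lead to a contradiction\<close>

lemma rich_mono: "rich E b1 b2 N \<Longrightarrow> E \<subseteq> F \<Longrightarrow> rich F b1 b2 N"
  for E :: "(nat \<Rightarrow> 'a::{finite,comm_semiring_0}) set"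
  unfolding rich_def
proof (elim exE)
  fix a assume N: "N \<le> real (card {(s1, s2). (\<lambda>i. a i + s1 * b1 i + s2 * b2 i) \<in> E})" and "E \<subseteq> F"
  then have "card {(s1, s2). (\<lambda>i. a i + s1 * b1 i + s2 * b2 i) \<in> E}
    \<le> card {(s1, s2). (\<lambda>i. a i + s1 * b1 i + s2 * b2 i) \<in> F}"
    by (intro card_mono) auto
  with N show "\<exists>a. N \<le> real (card {(s1, s2). (\<lambda>i. a i + s1 * b1 i + s2 * b2 i) \<in> F})"
    by (intro exI[of _ a]) linarith
qed

lemma card_bad_maps_less:
  fixes S :: "(nat \<Rightarrow> 'a::{finite,field}) set" and n t :: nat and \<tau> \<delta> :: real
  defines "Q \<equiv> real (card (UNIV :: 'a set))"
  defines "\<mu> \<equiv> real (card S) / Q ^ (t + 2)"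
  assumes n: "5 \<le> n" "t + 4 \<le> n" "1 \<le> t" and S: "S \<subseteq> vecs n" and pos: "0 < \<tau>" "0 < \<delta>" "\<delta> < 1"
    and q: "32 * real n \<le> Q" "32 * real n * (1 + \<tau>) \<le> (\<tau> * \<delta>)\<^sup>2 * Q" and card: "Q ^ (t + 3) < real (card S)"
    and B: "B \<subseteq> surj_lin_maps t n"
    and bad: "\<And>L. L \<in> B \<Longrightarrow> \<exists>y\<in>vecs t. \<tau> * \<mu> < \<bar>real (card (fiber S t n L y)) / Q\<^sup>2 - \<mu>\<bar>"
  shows "real (card B) < \<delta> * real (card (surj_lin_maps t n :: (nat \<Rightarrow> nat \<Rightarrow> 'a) set))"
proof (rule ccontr)
  let ?q = "card (UNIV :: 'a set)" and ?m = "t + 2" and ?X = "mats (t + 2) n :: (nat \<Rightarrow> nat \<Rightarrow> 'a) set"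
  assume "\<not> ?thesis"
  then have many: "\<delta> * real (card (surj_lin_maps t n :: (nat \<Rightarrow> nat \<Rightarrow> 'a) set)) \<le> real (card B)" by simp
  have Q: "160 \<le> Q" using n(1) q(1) by simp
  have nr: "5 \<le> real n" using n(1) by simp
  \<comment> \<open>The gap of three between \<open>r\<close> and \<open>t\<close> enters here: two
    dimensions go into the planes, the third makes the mean fibre exceed \<open>Q\<close>.\<close>
  have \<mu>: "Q < \<mu>" using card Q unfolding \<mu>_def by (simp add: field_simps power_add eval_nat_numeral)
  then have \<mu>pos: "0 < \<mu>" using Q by simp
  have \<tau>\<mu>: "32 * real n * (1 + \<tau>) \<le> \<delta>\<^sup>2 * (\<tau>\<^sup>2 * \<mu>)"
  proof -
    have "(\<tau> * \<delta>)\<^sup>2 * Q \<le> (\<tau> * \<delta>)\<^sup>2 * \<mu>" using \<mu> by (intro mult_left_mono) auto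
    then show ?thesis using q(2) by (simp add: power_mult_distrib mult_ac)
  qed
  define \<eta> where "\<eta> = 1 / (4 * real n)"
  define N where "N = (1 - \<eta>) * Q\<^sup>2"
  define W where "W G = deviant S ?m n \<mu> (\<tau> * \<mu> / 2) G" for G
  have \<eta>: "8 * (1 + \<tau>) \<le> \<eta> * (\<tau>\<^sup>2 * \<mu>)"
  proof -
    have "\<delta>\<^sup>2 \<le> 1" using pos by (simp add: power_le_one)
    then have "\<delta>\<^sup>2 * (\<tau>\<^sup>2 * \<mu>) \<le> 1 * (\<tau>\<^sup>2 * \<mu>)" using \<mu>pos by (intro mult_right_mono) auto
    then show ?thesis using \<tau>\<mu> nr by (simp add: \<eta>_def field_simps)
  qed
  have q4: "4 * ?q ^ t \<le> ?q ^ n"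
  proof -
    have "1 * 4 \<le> ?q ^ (n - t - 1) * ?q" using Q by (intro mult_mono) (auto simp: Q_def Suc_le_eq)
    then have "?q ^ t * 4 \<le> ?q ^ t * (?q ^ (n - t - 1) * ?q)" by (intro mult_le_mono2) simp
    also have "\<dots> = ?q ^ (t + (n - t - 1) + 1)" by (simp add: power_add)
    also have "t + (n - t - 1) + 1 = n" using n by simp
    finally show ?thesis by (simp add: mult.commute)
  qed
  \<comment> \<open>One factor 2 is lost in passing from surjective maps to all matrices, another in
    \<open>card_coordinate_rich\<close>.\<close>
  have cov0: "\<delta> / 4 * real (card ?X) \<le> real (card {G \<in> ?X. coordinate_rich (W G) t N})"
  proof -
    let ?M = "real (card (mats 2 n :: (nat \<Rightarrow> nat \<Rightarrow> 'a) set))"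
    have "B \<subseteq> mats t n" using B by (auto simp: surj_lin_maps_def)
    from card_coordinate_rich[OF S pos(1) \<mu>pos \<eta> this]
    have "real (card B) * ?M \<le> 2 * real (card {G \<in> ?X. coordinate_rich (W G) t N})"
      using bad unfolding W_def N_def Q_def by blast
    moreover have "\<delta> / 2 * real (card (mats t n :: (nat \<Rightarrow> nat \<Rightarrow> 'a) set)) * ?M \<le> real (card B) * ?M"
    proof (rule mult_right_mono)
      have "real (card (mats t n :: (nat \<Rightarrow> nat \<Rightarrow> 'a) set)) \<le> 2 * real (card (surj_lin_maps t n :: (nat \<Rightarrow> nat \<Rightarrow> 'a) set))"
        by (rule card_surj_lin_maps[OF q4])
      then have "\<delta> / 2 * real (card (mats t n :: (nat \<Rightarrow> nat \<Rightarrow> 'a) set))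
        \<le> \<delta> / 2 * (2 * real (card (surj_lin_maps t n :: (nat \<Rightarrow> nat \<Rightarrow> 'a) set)))"
        using pos by (intro mult_left_mono) auto
      with many show "\<delta> / 2 * real (card (mats t n :: (nat \<Rightarrow> nat \<Rightarrow> 'a) set)) \<le> real (card B)" by simp
    qed simp
    ultimately show ?thesis unfolding card_mats_add by simp
  qed
  \<comment> \<open>Chebyshev at the threshold \<open>\<tau> * \<mu> / 2\<close> gives density
    \<open>4 / (\<tau> ^ 2 * \<mu>)\<close>, at most \<open>\<delta> ^ 2 / (8 * n)\<close>.\<close>
  define \<rho> where "\<rho> = Q ^ ?m * (\<delta>\<^sup>2 / (8 * real n))"
  have avg: "(\<Sum>G\<in>?X. real (card (W G))) \<le> \<rho> * real (card ?X)"
  proof -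
    have "(\<Sum>G\<in>?X. real (card (W G))) \<le> real (card S) / (\<tau> * \<mu> / 2)\<^sup>2 * real (card ?X)"
      unfolding W_def
    proof (rule sum_card_deviant[OF S])
      show "0 < \<tau> * \<mu> / 2" using pos(1) \<mu>pos by simp
      show "\<mu> = real (card S) / real ?q ^ ?m" by (simp only: \<mu>_def Q_def)
    qed
    also have "\<dots> \<le> \<rho> * real (card ?X)"
    proof (rule mult_right_mono)
      have "real (card S) = \<mu> * Q ^ ?m" using Q by (simp add: \<mu>_def)
      then have "real (card S) / (\<tau> * \<mu> / 2)\<^sup>2 = Q ^ ?m * (4 / (\<tau>\<^sup>2 * \<mu>))"
        using \<mu>pos by (simp add: power_divide power_mult_distrib power2_eq_square)
      also have "4 / (\<tau>\<^sup>2 * \<mu>) \<le> \<delta>\<^sup>2 / (8 * real n)"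
      proof -
        have "32 * real n * 1 \<le> 32 * real n * (1 + \<tau>)" using pos by (intro mult_left_mono) auto
        then have "32 * real n \<le> \<delta>\<^sup>2 * (\<tau>\<^sup>2 * \<mu>)" using \<tau>\<mu> by simp
        then show ?thesis using pos \<mu>pos nr by (simp add: field_simps)
      qed
      finally show "real (card S) / (\<tau> * \<mu> / 2)\<^sup>2 \<le> \<rho>" using Q by (simp add: \<rho>_def)
    qed simp
    finally show ?thesis .
  qed
  let ?U = "indep_pairs ?m :: ((nat \<Rightarrow> 'a) \<times> (nat \<Rightarrow> 'a)) set"
  let ?C = "\<lambda>b G. rich (W G) (fst b) (snd b) N"
  \<comment> \<open>The weight \<open>2 * Q ^ ?m\<close> makes the density of the union at most half
    the share of covered pairs, hence at most 1/2.\<close>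
  obtain Y where Y: "Y \<subseteq> ?X"
    "2 * Q ^ ?m * real (card (\<Union>(W ` Y))) \<le> real (card {b \<in> ?U. \<exists>G\<in>Y. ?C b G})"
    "\<delta> / 4 * real (card {b \<in> ?U. \<not> (\<exists>G\<in>Y. ?C b G)}) \<le> 2 * Q ^ ?m * \<rho>"
  proof (rule greedy_cover[of ?X ?U W "\<delta> / 4" "\<lambda>G b. ?C b G" \<rho> "2 * Q ^ ?m"])
    show "?X \<noteq> {}" using zero_mat_in_mats by auto
    show "finite (W G)" for G by (rule finite_subset[of _ "vecs ?m"]) (auto simp: W_def deviant_def)
    show "\<delta> / 4 * real (card ?X) \<le> real (card {G \<in> ?X. ?C b G})" if "b \<in> ?U" for b
    proof -
      have "(fst b, snd b) \<in> ?U" using that by simp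
      from card_rich_ge[OF this, of n S \<mu> "\<tau> * \<mu> / 2" N]
      have "real (card {G \<in> ?X. coordinate_rich (W G) t N}) \<le> real (card {G \<in> ?X. ?C b G})"
        unfolding W_def by (rule of_nat_mono)
      with cov0 show ?thesis by simp
    qed
    show "0 \<le> 2 * Q ^ ?m" using Q by simp
  qed (use avg that in auto)
  define D where "D = {b \<in> ?U. \<exists>G\<in>Y. ?C b G}"
  define R where "R = {b \<in> ?U. \<not> (\<exists>G\<in>Y. ?C b G)}"
  have QQ: "Q ^ (2 * ?m) = Q ^ ?m * Q ^ ?m" by (simp add: power_add mult_2)
  have D_sub: "D \<subseteq> vecs ?m \<times> vecs ?m" using indep_pairs_subset by (auto simp: D_def)
  \<comment> \<open>The covering rate \<open>\<delta> / 4\<close> cancels one factor of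
    \<open>\<delta> ^ 2\<close> in \<open>\<rho>\<close>; \<open>\<delta> < 1\<close> and
    \<open>n \<ge> 5\<close> then give 1/5.\<close>
  have R5: "5 * real (card R) \<le> Q ^ (2 * ?m)"
  proof -
    have "\<delta> / 4 * real (card R) \<le> Q ^ (2 * ?m) * (\<delta>\<^sup>2 / (4 * real n))"
      using Y(3) unfolding R_def[symmetric] \<rho>_def QQ by (simp add: mult_ac)
    also have "\<dots> = \<delta> / 4 * (Q ^ (2 * ?m) * \<delta> / real n)" by (simp add: power2_eq_square)
    finally have "real (card R) \<le> Q ^ (2 * ?m) * \<delta> / real n" using pos by (subst (asm) mult_le_cancel_left_pos) auto
    also have "\<dots> \<le> Q ^ (2 * ?m) * 1 / 5"
      using nr pos Q by (intro frac_le mult_left_mono) auto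
    finally show ?thesis by simp
  qed
  \<comment> \<open>Dependent pairs make up at most 1/80 since \<open>Q \<ge> 160\<close>; together
    with \<open>R5\<close> at least half of all pairs remain in \<open>D\<close>.\<close>
  have U: "Q ^ (2 * ?m) \<le> real (card ?U) + Q ^ (2 * ?m) / 80"
  proof -
    have "real (?q ^ (2 * ?m)) \<le> real (card ?U + 2 * ?q ^ (?m + 1))"
      using card_indep_pairs[where m = ?m and 'a = 'a] by (simp only: of_nat_le_iff)
    moreover have "160 * Q ^ (?m + 1) \<le> Q ^ (2 * ?m)"
    proof -
      have "160 * Q ^ (?m + 1) \<le> Q * Q ^ (?m + 1)" using Q by (intro mult_right_mono) auto
      also have "\<dots> = Q ^ (?m + 2)" by simp
      also have "\<dots> \<le> Q ^ (2 * ?m)" using Q n(3) by (intro power_increasing) auto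
      finally show ?thesis .
    qed
    ultimately show ?thesis by (simp add: Q_def)
  qed
  have "?U = D \<union> R" by (auto simp: D_def R_def)
  then have "real (card ?U) \<le> real (card D) + real (card R)"
    using card_Un_le[of D R] by (simp flip: of_nat_add)
  then have "Q ^ (2 * ?m) \<le> 2 * real (card D)" using U R5 by linarith
  then have "Q ^ ?m < 2 * real (card (\<Union>(W ` Y)))" unfolding Q_def
  proof (rule kakeya_density[rotated -1])
    show "finite (\<Union>(W ` Y))" by (rule finite_subset[of _ "vecs ?m"]) (auto simp: W_def deviant_def)
    show "?m \<le> n" "1 \<le> n" using n by auto
    have "real (32 * n) \<le> real ?q" using q(1) by (simp add: Q_def)
    then show "32 * n \<le> ?q" by (simp only: of_nat_le_iff)
    show "rich (\<Union>(W ` Y)) b1 b2 ((1 - 1 / (4 * real n)) * (real ?q)\<^sup>2)" if b: "(b1, b2) \<in> D" for b1 b2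
    proof -
      from b obtain G where G: "G \<in> Y" "rich (W G) b1 b2 N" by (auto simp: D_def)
      then have "rich (\<Union>(W ` Y)) b1 b2 N" by (intro rich_mono[OF G(2)]) auto
      then show ?thesis by (simp add: N_def \<eta>_def Q_def)
    qed
  qed (rule D_sub)
  \<comment> \<open>The union has density above 1/2, but its size was charged to \<open>D\<close>,
    which has at most \<open>Q ^ (2 * ?m)\<close> elements.\<close>
  then have "Q ^ ?m * Q ^ ?m < Q ^ ?m * (2 * real (card (\<Union>(W ` Y))))"
    using Q by (intro mult_strict_left_mono) auto
  also have "\<dots> \<le> real (card D)" using Y(2) by (simp add: D_def mult_ac)
  also have "card D \<le> card (vecs ?m \<times> vecs ?m :: ((nat \<Rightarrow> 'a) \<times> (nat \<Rightarrow> 'a)) set)"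
    by (rule card_mono[OF _ D_sub]) simp
  also have "real \<dots> = Q ^ ?m * Q ^ ?m" by (simp add: card_cartesian_product card_vecs Q_def)
  finally show False by simp
qed

theorem mainTheorem1:
  fixes S :: "(nat \<Rightarrow> 'a::{finite,field}) set"
    and n r :: nat and \<tau> \<delta> :: real
  assumes "n \<ge> 5"
    and "S \<subseteq> vecs n"
    and "\<tau> > 0" and "0 < \<delta>" and "\<delta> < 1"
    and "real (card (UNIV :: 'a set)) \<ge> 32 * max (real n * (1 + \<tau>) / (\<tau> * \<delta>)^2) (real n)"
    and "4 \<le> r" and "r \<le> n - 1"
    and "card (UNIV :: 'a set) ^ r < card S" and "card S \<le> card (UNIV :: 'a set) ^ (r + 1)"
  shows "real (card {M \<in> surj_lin_maps (r - 3) n.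
            close_to_uniform (r - 3) (\<tau> / real (card (UNIV :: 'a set)) ^ (r - 3)) S (apply_mat (r - 3) n M)})
         \<ge> (1 - \<delta>) * real (card (surj_lin_maps (r - 3) n :: (nat \<Rightarrow> nat \<Rightarrow> 'a) set))"
proof -
  define t where "t = r - 3"
  let ?q = "card (UNIV :: 'a set)" and ?X = "surj_lin_maps t n :: (nat \<Rightarrow> nat \<Rightarrow> 'a) set"
  define close where "close M \<longleftrightarrow> close_to_uniform t (\<tau> / real ?q ^ t) S (apply_mat t n M)" for M
  define Q where "Q = real ?q"
  define B where "B = {M \<in> ?X. \<not> close M}"
  have r: "r = t + 3" and t: "1 \<le> t" "t + 4 \<le> n" using assms(1,7,8) by (auto simp: t_def)
  have q: "32 * real n \<le> Q" "32 * (real n * (1 + \<tau>) / (\<tau> * \<delta>)\<^sup>2) \<le> Q" using assms(6) by (auto simp: Q_def)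
  have Q: "0 < Q" by (simp add: Q_def card_gt_0_iff)
  have finX: "finite ?X" by (rule finite_subset[of _ "mats t n"]) (auto simp: surj_lin_maps_def)
  have cS: "Q ^ (t + 3) < real (card S)"
  proof -
    have "real (?q ^ r) < real (card S)" using assms(9) by (simp only: of_nat_less_iff)
    then show ?thesis by (simp add: Q_def r)
  qed
  have "real (card B) < \<delta> * real (card ?X)"
  proof (rule card_bad_maps_less[OF assms(1) t(2,1) assms(2-5), folded Q_def])
    show "32 * real n * (1 + \<tau>) \<le> (\<tau> * \<delta>)\<^sup>2 * Q"
      using q(2) assms(3,4) by (simp add: field_simps)
    show "B \<subseteq> ?X" by (auto simp: B_def)
    fix L assume "L \<in> B"
    then obtain y where y: "y \<in> vecs t"
      "\<tau> / Q ^ t < \<bar>real (card (fiber S t n L y)) / real (card S) - 1 / Q ^ t\<bar>"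
      by (auto simp: B_def close_def close_to_uniform_def prob_image_def fiber_def Q_def not_le)
    have S0: "0 < real (card S)" using cS Q by (meson less_trans zero_less_power)
    \<comment> \<open>This factor turns deviations of probabilities from \<open>1 / Q ^ t\<close>
      into deviations of the normalized fibre size from the mean
      \<open>card S / Q ^ (t + 2)\<close>.\<close>
    have scale: "real (card S) / Q\<^sup>2 > 0" using S0 Q by simp
    from mult_strict_left_mono[OF y(2) this]
    have "real (card S) / Q\<^sup>2 * (\<tau> / Q ^ t)
      < \<bar>real (card S) / Q\<^sup>2 * (real (card (fiber S t n L y)) / real (card S) - 1 / Q ^ t)\<bar>"
      using scale by (simp add: abs_mult)
    also have "real (card S) / Q\<^sup>2 * (real (card (fiber S t n L y)) / real (card S) - 1 / Q ^ t)
      = real (card (fiber S t n L y)) / Q\<^sup>2 - real (card S) / Q ^ (t + 2)"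
      using S0 Q by (simp add: field_simps power_add power2_eq_square)
    also have "real (card S) / Q\<^sup>2 * (\<tau> / Q ^ t) = \<tau> * (real (card S) / Q ^ (t + 2))"
      by (simp add: power_add power2_eq_square mult_ac)
    finally show "\<exists>y\<in>vecs t. \<tau> * (real (card S) / Q ^ (t + 2))
      < \<bar>real (card (fiber S t n L y)) / Q\<^sup>2 - real (card S) / Q ^ (t + 2)\<bar>" using y(1) by blast
  qed (use q(1) cS in auto)
  moreover have "card ?X = card {M \<in> ?X. close M} + card B"
  proof -
    have "?X = {M \<in> ?X. close M} \<union> B" "{M \<in> ?X. close M} \<inter> B = {}" by (auto simp: B_def)
    then show ?thesis using card_Un_disjoint[of "{M \<in> ?X. close M}" B] finX by (simp add: B_def)
  qed
  ultimately have "(1 - \<delta>) * real (card ?X) \<le> real (card {M \<in> ?X. close M})"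
    by (simp add: left_diff_distrib)
  then show ?thesis unfolding close_def t_def .
qed

end
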